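(* Let $R$ be a unital ring and let $M$ be a left $R$-module with finite Krull-Schmidt length. Then the following conditions are equivalent: 1. $M$ satisfies the $AKS_1$ condition. 2. $M$ satisfies the $AKS_2$ condition. 3. $M$ satisfies the $AKS_3$ condition. 4. $M$ satisfies the $AKS_4$ condition.
   Context: A direct sum decomposition of $M$ is an internal decomposition $M=\bigoplus_{\alpha\in A}M_\alpha$ with all $M_\alpha$ nonzero; its cardinality is that of $A$; it is indecomposable if every $M_\alpha$ is indecomposable. The Krull-Schmidt length of $M$ is the supremum of all cardinalities of direct sum decompositions of $M$. Two decompositions $M=\bigoplus_{\alpha\in A}M_\alpha$ and $M=\bigoplus_{\beta\in B}N_\beta$ are decomposition-isomorphic if there is a bijection $\phi:A\to B$ such that $M_\alpha\cong N_{\phi(\alpha)}$ for every $\alpha\in A$. $M$ satisfies $AKS_1$ if it admits only finitely many direct sum decompositions up to decomposition-isomorphisms; $AKS_2$ if it has only finitely many indecomposable direct sum decompositions up to decomposition-isomorphisms; $AKS_3$ if it has only finitely many direct summands up to isomorphism; $AKS_4$ if it has only finitely many indecomposable direct summands up to isomorphism. *)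

theory Defs
  imports "HOL-Algebra.Algebra" "HOL-Library.Extended_Nat"
begin

text \<open>The library locale \<^locale>\<open>module\<close> requires a commutative scalar ring; \<^locale>\<open>ring\<close> does not,
  and is unital.\<close>

locale left_module = R?: ring R + M?: abelian_group M
  for R :: "('r, 'p) ring_scheme" (structure) and M :: "('r, 'm, 'q) module_scheme" (structure) +
  assumes smult_closed [simp, intro]:
      "\<lbrakk>a \<in> carrier R; x \<in> carrier M\<rbrakk> \<Longrightarrow> a \<odot>\<^bsub>M\<^esub> x \<in> carrier M"
    and smult_l_distr:
      "\<lbrakk>a \<in> carrier R; b \<in> carrier R; x \<in> carrier M\<rbrakk> \<Longrightarrow>
        (a \<oplus> b) \<odot>\<^bsub>M\<^esub> x = a \<odot>\<^bsub>M\<^esub> x \<oplus>\<^bsub>M\<^esub> b \<odot>\<^bsub>M\<^esub> x"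
    and smult_r_distr:
      "\<lbrakk>a \<in> carrier R; x \<in> carrier M; y \<in> carrier M\<rbrakk> \<Longrightarrow>
        a \<odot>\<^bsub>M\<^esub> (x \<oplus>\<^bsub>M\<^esub> y) = a \<odot>\<^bsub>M\<^esub> x \<oplus>\<^bsub>M\<^esub> a \<odot>\<^bsub>M\<^esub> y"
    and smult_assoc1:
      "\<lbrakk>a \<in> carrier R; b \<in> carrier R; x \<in> carrier M\<rbrakk> \<Longrightarrow>
        (a \<otimes> b) \<odot>\<^bsub>M\<^esub> x = a \<odot>\<^bsub>M\<^esub> (b \<odot>\<^bsub>M\<^esub> x)"
    and smult_one [simp]: "x \<in> carrier M \<Longrightarrow> \<one> \<odot>\<^bsub>M\<^esub> x = x"

text \<open>A submodule \<open>N\<close> is a set; as a module in its own right it is \<open>M\<lparr>carrier := N\<rparr>\<close>.\<close>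

definition module_isomorphic ::
    "('r, 'p) ring_scheme \<Rightarrow> ('r, 'm, 'q) module_scheme \<Rightarrow> ('r, 'n, 's) module_scheme \<Rightarrow> bool"
  where "module_isomorphic R M N \<longleftrightarrow>
    (\<exists>f \<in> iso (add_monoid M) (add_monoid N).
      \<forall>a \<in> carrier R. \<forall>x \<in> carrier M. f (a \<odot>\<^bsub>M\<^esub> x) = a \<odot>\<^bsub>N\<^esub> f x)"

definition submodule_isomorphic ::
    "('r, 'p) ring_scheme \<Rightarrow> ('r, 'm, 'q) module_scheme \<Rightarrow> 'm set \<Rightarrow> 'm set \<Rightarrow> bool"
  where "submodule_isomorphic R M N K \<longleftrightarrow>
    module_isomorphic R (M\<lparr>carrier := N\<rparr>) (M\<lparr>carrier := K\<rparr>)"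

definition complementary_submodules ::
    "('r, 'p) ring_scheme \<Rightarrow> ('r, 'm, 'q) module_scheme \<Rightarrow> 'm set \<Rightarrow> 'm set \<Rightarrow> bool"
  where "complementary_submodules R M N K \<longleftrightarrow>
    submodule N R M \<and> submodule K R M \<and> N \<inter> K = {\<zero>\<^bsub>M\<^esub>} \<and> N <+>\<^bsub>M\<^esub> K = carrier M"

definition direct_summand ::
    "('r, 'p) ring_scheme \<Rightarrow> ('r, 'm, 'q) module_scheme \<Rightarrow> 'm set \<Rightarrow> bool"
  where "direct_summand R M N \<longleftrightarrow> (\<exists>K. complementary_submodules R M N K)"

definition indecomposable_module ::
    "('r, 'p) ring_scheme \<Rightarrow> ('r, 'm, 'q) module_scheme \<Rightarrow> bool"
  where "indecomposable_module R M \<longleftrightarrow>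
    carrier M \<noteq> {\<zero>\<^bsub>M\<^esub>} \<and>
    \<not> (\<exists>N K. N \<noteq> {\<zero>\<^bsub>M\<^esub>} \<and> K \<noteq> {\<zero>\<^bsub>M\<^esub>} \<and> complementary_submodules R M N K)"

definition direct_sum_family ::
    "('r, 'p) ring_scheme \<Rightarrow> ('r, 'm, 'q) module_scheme \<Rightarrow> 'i set \<Rightarrow> ('i \<Rightarrow> 'm set) \<Rightarrow> bool"
  where "direct_sum_family R M A N \<longleftrightarrow>
    (\<forall>i \<in> A. submodule (N i) R M \<and> N i \<noteq> {\<zero>\<^bsub>M\<^esub>}) \<and>
    (\<forall>m \<in> carrier M. \<exists>!x. x \<in> (\<Pi>\<^sub>E i\<in>A. N i) \<and> finite {i \<in> A. x i \<noteq> \<zero>\<^bsub>M\<^esub>} \<and>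
      m = finsum M x {i \<in> A. x i \<noteq> \<zero>\<^bsub>M\<^esub>})"

text \<open>The members of a direct sum family are nonzero, hence pairwise distinct, so an internal direct
  sum decomposition is determined by its set of summands, which indexes itself. This keeps index
  sets of arbitrary type out of the quantifications over all decompositions below; the two lemmas
  after the definition show that no decomposition, and no cardinality, is lost. The zero module
  has exactly one decomposition, the empty one.\<close>

definition direct_decompositions ::
    "('r, 'p) ring_scheme \<Rightarrow> ('r, 'm, 'q) module_scheme \<Rightarrow> 'm set set set"
  where "direct_decompositions R M = {D. direct_sum_family R M D (\<lambda>N. N)}"

lemma (in left_module) direct_sum_family_inj_on:
  assumes "direct_sum_family R M A N"
  shows "inj_on N A"
proof (rule inj_onI, rule ccontr)
  fix i j assume ij: "i \<in> A" "j \<in> A" "N i = N j" "i \<noteq> j"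
  have sub: "submodule (N k) R M" if "k \<in> A" for k
    using assms that unfolding direct_sum_family_def by blast
  have z: "\<zero>\<^bsub>M\<^esub> \<in> N k" if "k \<in> A" for k
    using subgroup.one_closed[OF submodule.axioms(1)[OF sub[OF that]]] by simp
  have "N i \<noteq> {\<zero>\<^bsub>M\<^esub>}"
    using assms ij unfolding direct_sum_family_def by blast
  then obtain m where m: "m \<in> N i" "m \<noteq> \<zero>\<^bsub>M\<^esub>"
    using z[OF ij(1)] by blast
  have mc: "m \<in> carrier M"
    using subgroup.subset[OF submodule.axioms(1)[OF sub[OF ij(1)]]] m by auto
  define u where "u k = (\<lambda>l\<in>A. if l = k then m else \<zero>\<^bsub>M\<^esub>)" for k
  have supp: "{l \<in> A. u k l \<noteq> \<zero>\<^bsub>M\<^esub>} = {k}" if "k \<in> A" for k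
    using that m by (auto simp: u_def)
  have rep: "u k \<in> (\<Pi>\<^sub>E i\<in>A. N i) \<and> finite {l \<in> A. u k l \<noteq> \<zero>\<^bsub>M\<^esub>} \<and>
      m = finsum M (u k) {l \<in> A. u k l \<noteq> \<zero>\<^bsub>M\<^esub>}" if "k \<in> A" "m \<in> N k" for k
  proof -
    have "finsum M (u k) {k} = m"
      using that mc M.finsum_insert[of "{}" k "u k"] by (simp add: u_def)
    moreover have "u k \<in> (\<Pi>\<^sub>E i\<in>A. N i)"
      using that z by (auto simp: u_def)
    ultimately show ?thesis using supp[OF that(1)] by simp
  qed
  have "u i = u j"
    using assms mc rep[OF ij(1) m(1)] rep[of j] ij m(1)
    unfolding direct_sum_family_def by blast
  then have "u i i = u j i" by simp
  then show False using ij m by (simp add: u_def)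
qed

lemma (in left_module) direct_sum_family_image:
  assumes "direct_sum_family R M A N"
  shows "N ` A \<in> direct_decompositions R M"
proof -
  have inj: "inj_on N A" using assms by (rule direct_sum_family_inj_on)
  have sub: "submodule (N k) R M" if "k \<in> A" for k
    using assms that unfolding direct_sum_family_def by blast
  have car: "N k \<subseteq> carrier M" if "k \<in> A" for k
    using subgroup.subset[OF submodule.axioms(1)[OF sub[OF that]]] by simp
  let ?P = "\<lambda>m x. x \<in> (\<Pi>\<^sub>E i\<in>A. N i) \<and> finite {i \<in> A. x i \<noteq> \<zero>\<^bsub>M\<^esub>} \<and>
      m = finsum M x {i \<in> A. x i \<noteq> \<zero>\<^bsub>M\<^esub>}"
  let ?Q = "\<lambda>m y. y \<in> (\<Pi>\<^sub>E K\<in>N ` A. K) \<and> finite {K \<in> N ` A. y K \<noteq> \<zero>\<^bsub>M\<^esub>} \<and>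
      m = finsum M y {K \<in> N ` A. y K \<noteq> \<zero>\<^bsub>M\<^esub>}"
  let ?pull = "\<lambda>y. \<lambda>i\<in>A. y (N i)"
  have PQ: "?P m (?pull y) \<longleftrightarrow> ?Q m y" if y: "y \<in> extensional (N ` A)" for m y
  proof -
    let ?S = "{i \<in> A. y (N i) \<noteq> \<zero>\<^bsub>M\<^esub>}"
    have S: "{i \<in> A. ?pull y i \<noteq> \<zero>\<^bsub>M\<^esub>} = ?S" by auto
    have im: "{K \<in> N ` A. y K \<noteq> \<zero>\<^bsub>M\<^esub>} = N ` ?S" by auto
    have injS: "inj_on N ?S" using inj by (rule inj_on_subset) auto
    have mem: "?pull y \<in> (\<Pi>\<^sub>E i\<in>A. N i) \<longleftrightarrow> y \<in> (\<Pi>\<^sub>E K\<in>N ` A. K)"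
      using y by (auto simp: PiE_iff)
    have sum: "finsum M y (N ` ?S) = finsum M (?pull y) ?S"
      if "y \<in> (\<Pi>\<^sub>E K\<in>N ` A. K)"
    proof -
      have yc: "y (N i) \<in> carrier M" if "i \<in> A" for i
        using \<open>y \<in> (\<Pi>\<^sub>E K\<in>N ` A. K)\<close> that car[OF that] by (auto simp: PiE_iff)
      have "finsum M y (N ` ?S) = finsum M (\<lambda>i. y (N i)) ?S"
        using yc injS by (intro M.finsum_reindex) auto
      also have "\<dots> = finsum M (?pull y) ?S"
        using yc by (intro M.finsum_cong') auto
      finally show ?thesis .
    qed
    have fin: "finite (N ` ?S) \<longleftrightarrow> finite ?S"
      using injS by (rule finite_image_iff)
    show ?thesis
      unfolding S im mem fin by (intro conj_cong refl) (simp only: sum)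
  qed
  have "\<exists>!y. ?Q m y" if m: "m \<in> carrier M" for m
  proof -
    have ex: "\<exists>!x. ?P m x" using assms m unfolding direct_sum_family_def by blast
    then obtain x where x: "?P m x" by blast
    define y where "y = (\<lambda>K\<in>N ` A. x (the_inv_into A N K))"
    have "?pull y = x"
      using x inj by (auto simp: y_def the_inv_into_f_f PiE_iff extensional_def fun_eq_iff)
    moreover have "y \<in> extensional (N ` A)" by (simp add: y_def)
    ultimately have "?Q m y" using PQ[of y m] x by simp
    moreover have "y' = y" if y': "?Q m y'" for y'
    proof -
      have e': "y' \<in> extensional (N ` A)" using y' by (simp add: PiE_iff)
      have "?P m (?pull y')" using PQ[OF e', of m] y' by blast
      then have "?pull y' = x" using ex x by blast
      then have eq: "?pull y' = ?pull y" using \<open>?pull y = x\<close> by simp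
      have "y' (N i) = y (N i)" if "i \<in> A" for i
        using fun_cong[OF eq, of i] that by simp
      then show "y' = y"
        using e' \<open>y \<in> extensional (N ` A)\<close> by (intro extensionalityI) auto
    qed
    ultimately show ?thesis by (rule ex1I)
  qed
  moreover have "\<forall>K \<in> N ` A. submodule K R M \<and> K \<noteq> {\<zero>\<^bsub>M\<^esub>}"
    using assms unfolding direct_sum_family_def by blast
  ultimately show ?thesis
    unfolding direct_decompositions_def direct_sum_family_def by simp
qed

definition indecomposable_decompositions ::
    "('r, 'p) ring_scheme \<Rightarrow> ('r, 'm, 'q) module_scheme \<Rightarrow> 'm set set set"
  where "indecomposable_decompositions R M =
    {D \<in> direct_decompositions R M. \<forall>N \<in> D. indecomposable_module R (M\<lparr>carrier := N\<rparr>)}"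

text \<open>All infinite cardinalities are identified with \<open>\<infinity>\<close>: only finiteness of the supremum matters.\<close>

definition krull_schmidt_length ::
    "('r, 'p) ring_scheme \<Rightarrow> ('r, 'm, 'q) module_scheme \<Rightarrow> enat"
  where "krull_schmidt_length R M =
    (SUP D \<in> direct_decompositions R M. if finite D then enat (card D) else \<infinity>)"

definition decomposition_isomorphic ::
    "('r, 'p) ring_scheme \<Rightarrow> ('r, 'm, 'q) module_scheme \<Rightarrow> 'm set set \<Rightarrow> 'm set set \<Rightarrow> bool"
  where "decomposition_isomorphic R M D E \<longleftrightarrow>
    (\<exists>\<phi>. bij_betw \<phi> D E \<and> (\<forall>N \<in> D. submodule_isomorphic R M N (\<phi> N)))"

definition finite_up_to :: "('a \<Rightarrow> 'a \<Rightarrow> bool) \<Rightarrow> 'a set \<Rightarrow> bool"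
  where "finite_up_to sim S \<longleftrightarrow> finite (S // {(x, y). x \<in> S \<and> y \<in> S \<and> sim x y})"

definition AKS1 :: "('r, 'p) ring_scheme \<Rightarrow> ('r, 'm, 'q) module_scheme \<Rightarrow> bool"
  where "AKS1 R M \<longleftrightarrow>
    finite_up_to (decomposition_isomorphic R M) (direct_decompositions R M)"

definition AKS2 :: "('r, 'p) ring_scheme \<Rightarrow> ('r, 'm, 'q) module_scheme \<Rightarrow> bool"
  where "AKS2 R M \<longleftrightarrow>
    finite_up_to (decomposition_isomorphic R M) (indecomposable_decompositions R M)"

definition AKS3 :: "('r, 'p) ring_scheme \<Rightarrow> ('r, 'm, 'q) module_scheme \<Rightarrow> bool"
  where "AKS3 R M \<longleftrightarrow>
    finite_up_to (submodule_isomorphic R M) {N. direct_summand R M N}"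

definition AKS4 :: "('r, 'p) ring_scheme \<Rightarrow> ('r, 'm, 'q) module_scheme \<Rightarrow> bool"
  where "AKS4 R M \<longleftrightarrow>
    finite_up_to (submodule_isomorphic R M)
      {N. direct_summand R M N \<and> indecomposable_module R (M\<lparr>carrier := N\<rparr>)}"

end

theory Submission
  imports Defs
begin

text \<open>
  The four conditions are shown equivalent along the cycle
  \<open>AKS1 \<Longrightarrow> AKS2 \<Longrightarrow> AKS4 \<Longrightarrow> AKS3 \<Longrightarrow> AKS1\<close>. Let \<open>n\<close> bound the cardinality of every direct sum
  decomposition of \<open>M\<close>.

  \<^item> \<open>AKS1 \<Longrightarrow> AKS2\<close>: indecomposable decompositions are decompositions, and finiteness up to a
    relation passes to subsets.

  \<^item> \<open>AKS2 \<Longrightarrow> AKS4\<close>: an indecomposable summand \<open>N\<close> with complement \<open>L\<close>, together with an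
    indecomposable decomposition of \<open>L\<close>, gives an indecomposable decomposition of \<open>M\<close>. So every
    \<open>N\<close> is isomorphic to a member of one of finitely many representative decompositions, and each
    of these is finite.

  \<^item> \<open>AKS4 \<Longrightarrow> AKS3\<close>: a summand has an indecomposable decomposition with at most \<open>n\<close> members, all
    of them indecomposable summands of \<open>M\<close>. If two summands have decompositions that match up
    to isomorphism, then they are isomorphic. There are only finitely many ways to choose at most
    \<open>n\<close> isomorphism classes, with repetition, out of finitely many.

  \<^item> \<open>AKS3 \<Longrightarrow> AKS1\<close>: a decomposition of \<open>M\<close> is itself a set of at most \<open>n\<close> summands, so the
    same count applies.

  The count is \<open>finite_up_to_matched\<close>. Everything about modules rests on a description
  of finite decompositions by adding one summand at a time (\<open>decompositions_insertI\<close> and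
  \<open>decompositions_insertE\<close>): for finite \<open>D\<close> and nonzero \<open>N \<notin> D\<close>,
  the set \<open>insert N D\<close> decomposes \<open>L\<close> exactly if \<open>L\<close> is
  the internal direct sum of \<open>N\<close> and a submodule \<open>K\<close> that \<open>D\<close> decomposes. With it, refining a
  member of a decomposition is associativity of internal direct sums of two submodules
  (\<open>splits_assoc\<close>), and a decomposition of maximal cardinality cannot be refined, hence is
  indecomposable (\<open>exists_indecomposable_decomposition\<close>). Likewise the isomorphism of modules
  with matching decompositions (\<open>isomorphic_if_decompositions_matched\<close>) is an induction over
  direct sums of two submodules.
\<close>

section \<open>Finiteness up to an equivalence\<close>

text \<open>Every class of the smaller set is the trace of a class of the larger one.\<close>

lemma finite_up_to_mono:
  assumes "finite_up_to sim T" "S \<subseteq> T"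
  shows "finite_up_to sim S"
proof -
  let ?r = "\<lambda>A. {(x, y). x \<in> A \<and> y \<in> A \<and> sim x y}"
  have "S // ?r S \<subseteq> (\<lambda>C. C \<inter> S) ` (T // ?r T)"
  proof
    fix C assume "C \<in> S // ?r S"
    then obtain x where "x \<in> S" "C = ?r S `` {x}" by (rule quotientE)
    then have "C = ?r T `` {x} \<inter> S" "x \<in> T" using assms(2) by auto
    then show "C \<in> (\<lambda>C. C \<inter> S) ` (T // ?r T)" by (blast intro: quotientI)
  qed
  then show ?thesis
    using assms(1) unfolding finite_up_to_def by (meson finite_imageI finite_subset)
qed

text \<open>Relative to a set rather than in the form \<open>equiv S r\<close>, which confines the relation to \<open>S \<times> S\<close>:
  one and the same isomorphism relation is used on several sets of submodules.\<close>

definition equivalence_on :: "'a set \<Rightarrow> ('a \<Rightarrow> 'a \<Rightarrow> bool) \<Rightarrow> bool"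
  where "equivalence_on S sim \<longleftrightarrow> reflp_on S sim \<and> symp_on S sim \<and> transp_on S sim"

lemma equivalence_on_subset:
  "equivalence_on T sim \<Longrightarrow> S \<subseteq> T \<Longrightarrow> equivalence_on S sim"
  unfolding equivalence_on_def by (meson reflp_on_subset symp_on_subset transp_on_subset)

lemma equivalence_onD:
  assumes "equivalence_on S sim"
  shows "x \<in> S \<Longrightarrow> sim x x"
    and "\<lbrakk>x \<in> S; y \<in> S; sim x y\<rbrakk> \<Longrightarrow> sim y x"
    and "\<lbrakk>x \<in> S; y \<in> S; z \<in> S; sim x y; sim y z\<rbrakk> \<Longrightarrow> sim x z"
  using assms unfolding equivalence_on_def reflp_on_def symp_on_def transp_on_def by blast+

lemma finite_up_to_iff_representatives:
  assumes "equivalence_on S sim"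
  shows "finite_up_to sim S \<longleftrightarrow> (\<exists>F. finite F \<and> F \<subseteq> S \<and> (\<forall>x \<in> S. \<exists>y \<in> F. sim x y))"
proof -
  define r where "r = {(x, y). x \<in> S \<and> y \<in> S \<and> sim x y}"
  note refl = equivalence_onD(1)[OF assms] and sym = equivalence_onD(2)[OF assms]
    and trans = equivalence_onD(3)[OF assms]
  have class_eq: "r `` {x} = r `` {y}" if xy: "x \<in> S" "y \<in> S" "sim x y" for x y
  proof -
    have "sim x z \<longleftrightarrow> sim y z" if "z \<in> S" for z
      using trans[OF xy(1,2) that xy(3)] trans[OF xy(2,1) that sym[OF xy]] by blast
    then show ?thesis using xy(1,2) unfolding r_def by auto
  qed
  have "finite (S // r) \<longleftrightarrow> (\<exists>F. finite F \<and> F \<subseteq> S \<and> (\<forall>x \<in> S. \<exists>y \<in> F. sim x y))"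
  proof
    assume fin: "finite (S // r)"
    define F where "F = (\<lambda>C. SOME y. y \<in> C) ` (S // r)"
    have pick: "(SOME y. y \<in> r `` {x}) \<in> r `` {x}" if "x \<in> S" for x
      by (rule someI[of _ x]) (simp add: r_def refl that)
    have "F \<subseteq> S" using pick unfolding F_def quotient_def r_def by auto
    moreover have "\<exists>y \<in> F. sim x y" if "x \<in> S" for x
      using pick[OF that] quotientI[OF that, of r] unfolding F_def r_def by blast
    ultimately show "\<exists>F. finite F \<and> F \<subseteq> S \<and> (\<forall>x \<in> S. \<exists>y \<in> F. sim x y)"
      using fin by (intro exI[of _ F]) (simp add: F_def)
  next
    assume "\<exists>F. finite F \<and> F \<subseteq> S \<and> (\<forall>x \<in> S. \<exists>y \<in> F. sim x y)"
    then obtain F where F: "finite F" "F \<subseteq> S" "\<forall>x \<in> S. \<exists>y \<in> F. sim x y" by blast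
    have "S // r \<subseteq> (\<lambda>y. r `` {y}) ` F"
    proof
      fix C assume "C \<in> S // r"
      then obtain x where "x \<in> S" "C = r `` {x}" by (rule quotientE)
      moreover from this obtain y where "y \<in> F" "sim x y" using F(3) by auto
      ultimately show "C \<in> (\<lambda>y. r `` {y}) ` F" using F(2) class_eq[of x y] by auto
    qed
    then show "finite (S // r)" using F(1) by (meson finite_imageI finite_subset)
  qed
  then show ?thesis unfolding finite_up_to_def r_def .
qed

text \<open>A choice of one element in each nonempty fibre of an invariant that separates classes and takes
  finitely many values is a finite set of representatives.\<close>

lemma finite_up_to_invariant:
  assumes "equivalence_on S sim"
    and fin: "finite (c ` S)"
    and complete: "\<And>x y. \<lbrakk>x \<in> S; y \<in> S; c x = c y\<rbrakk> \<Longrightarrow> sim x y"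
  shows "finite_up_to sim S"
proof -
  have "finite (inv_into S c ` c ` S)" using fin by simp
  moreover have "inv_into S c ` c ` S \<subseteq> S" by (auto intro: inv_into_into)
  moreover have "\<exists>y \<in> inv_into S c ` c ` S. sim x y" if x: "x \<in> S" for x
  proof
    show "sim x (inv_into S c (c x))"
      using x by (intro complete) (auto simp: inv_into_into f_inv_into_f)
  qed (use x in blast)
  ultimately show ?thesis
    unfolding finite_up_to_iff_representatives[OF assms(1)]
    by (intro exI[of _ "inv_into S c ` c ` S"]) simp
qed

lemma finite_up_to_pullback:
  assumes "equivalence_on S sim" and eq: "equivalence_on T sim'"
    and fin: "finite_up_to sim' T"
    and f: "\<And>x. x \<in> S \<Longrightarrow> f x \<in> T"
    and reflects: "\<And>x y. \<lbrakk>x \<in> S; y \<in> S; sim' (f x) (f y)\<rbrakk> \<Longrightarrow> sim x y"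
  shows "finite_up_to sim S"
proof -
  obtain F where F: "finite F" "F \<subseteq> T" "\<And>z. z \<in> T \<Longrightarrow> \<exists>y \<in> F. sim' z y"
    using fin finite_up_to_iff_representatives[OF eq] by metis
  then obtain rep where rep: "\<And>z. z \<in> T \<Longrightarrow> rep z \<in> F \<and> sim' z (rep z)" by metis
  show ?thesis
  proof (rule finite_up_to_invariant[OF assms(1), where c = "\<lambda>x. rep (f x)"])
    have "(\<lambda>x. rep (f x)) ` S \<subseteq> F" using rep f by auto
    then show "finite ((\<lambda>x. rep (f x)) ` S)" using F(1) by (rule finite_subset)
  next
    fix x y assume xy: "x \<in> S" "y \<in> S" "rep (f x) = rep (f y)"
    have mem: "rep (f y) \<in> T" using rep[OF f[OF xy(2)]] F(2) by auto
    have "sim' (rep (f y)) (f y)"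
      using equivalence_onD(2)[OF eq f[OF xy(2)] mem] rep[OF f[OF xy(2)]] by simp
    moreover have "sim' (f x) (rep (f y))" using rep[OF f[OF xy(1)]] xy(3) by simp
    ultimately have "sim' (f x) (f y)"
      using equivalence_onD(3)[OF eq f[OF xy(1)] mem f[OF xy(2)]] by simp
    then show "sim x y" using reflects xy(1,2) by simp
  qed
qed

text \<open>With \<open>sim\<close> the isomorphism of submodules, this is \<open>decomposition_isomorphic\<close>; the matching argument
  below also applies it to decompositions of two different modules.\<close>

definition matched :: "('a \<Rightarrow> 'a \<Rightarrow> bool) \<Rightarrow> 'a set \<Rightarrow> 'a set \<Rightarrow> bool"
  where "matched sim D E \<longleftrightarrow> (\<exists>\<phi>. bij_betw \<phi> D E \<and> (\<forall>x \<in> D. sim x (\<phi> x)))"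

lemma equivalence_on_matched:
  assumes "equivalence_on S sim"
  shows "equivalence_on (Pow S) (matched sim)"
proof -
  note refl = equivalence_onD(1)[OF assms] and sym = equivalence_onD(2)[OF assms]
    and trans = equivalence_onD(3)[OF assms]
  have refl': "matched sim D D" if "D \<subseteq> S" for D
    unfolding matched_def using refl that by (intro exI[of _ id]) auto
  have sym': "matched sim E D" if DE: "D \<subseteq> S" "E \<subseteq> S" "matched sim D E" for D E
  proof -
    obtain \<phi> where \<phi>: "bij_betw \<phi> D E" "\<And>x. x \<in> D \<Longrightarrow> sim x (\<phi> x)"
      using DE(3) unfolding matched_def by blast
    have "sim y (inv_into D \<phi> y)" if "y \<in> E" for y
    proof -
      have "inv_into D \<phi> y \<in> D" "\<phi> (inv_into D \<phi> y) = y"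
        using \<phi>(1) that by (auto simp: bij_betw_def inv_into_into f_inv_into_f)
      then show ?thesis
        using sym[of "inv_into D \<phi> y" y] \<phi>(2)[of "inv_into D \<phi> y"] DE(1,2) that
        by (simp add: subset_iff)
    qed
    then show ?thesis
      unfolding matched_def using bij_betw_inv_into[OF \<phi>(1)] by blast
  qed
  have trans': "matched sim D G"
    if DEG: "D \<subseteq> S" "E \<subseteq> S" "G \<subseteq> S" "matched sim D E" "matched sim E G" for D E G
  proof -
    obtain \<phi> \<psi> where \<phi>: "bij_betw \<phi> D E" "\<And>x. x \<in> D \<Longrightarrow> sim x (\<phi> x)"
      and \<psi>: "bij_betw \<psi> E G" "\<And>x. x \<in> E \<Longrightarrow> sim x (\<psi> x)"
      using DEG(4,5) unfolding matched_def by blast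
    have "sim x ((\<psi> \<circ> \<phi>) x)" if "x \<in> D" for x
    proof -
      have "\<phi> x \<in> E" "\<psi> (\<phi> x) \<in> G"
        using bij_betwE[OF \<phi>(1)] bij_betwE[OF \<psi>(1)] that by auto
      then show ?thesis
        using trans[of x "\<phi> x" "\<psi> (\<phi> x)"] \<phi>(2)[OF that] \<psi>(2)[of "\<phi> x"] DEG(1-3) that
        by (simp add: subset_iff)
    qed
    then show ?thesis
      unfolding matched_def using bij_betw_trans[OF \<phi>(1) \<psi>(1)] by blast
  qed
  show ?thesis
    unfolding equivalence_on_def
  proof (intro conjI)
    show "reflp_on (Pow S) (matched sim)" by (rule reflp_onI) (simp add: refl')
    show "symp_on (Pow S) (matched sim)" by (rule symp_onI) (simp add: sym')
    show "transp_on (Pow S) (matched sim)"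
      by (rule transp_onI) (rule trans', simp_all only: Pow_iff)
  qed
qed

text \<open>Choose a representative of each class and an enumeration of each set. The list of
  representatives of the enumerated elements is a word of length at most \<open>n\<close> over a finite
  alphabet. Two sets with the same word are matched by position: words
  may tell apart sets with the same multiset of classes, which only refines the finite count, but
  equality of words yields the bijection directly.\<close>

lemma finite_up_to_matched:
  assumes eq: "equivalence_on S sim"
    and fin: "finite_up_to sim S"
  shows "finite_up_to (matched sim) {D. D \<subseteq> S \<and> finite D \<and> card D \<le> n}"
proof -
  obtain F where F: "finite F" "F \<subseteq> S" "\<And>x. x \<in> S \<Longrightarrow> \<exists>y \<in> F. sim x y"
    using fin finite_up_to_iff_representatives[OF eq] by metis
  then obtain rep where rep: "\<And>x. x \<in> S \<Longrightarrow> rep x \<in> F \<and> sim x (rep x)" by metis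
  have rep_eq: "sim x y" if "x \<in> S" "y \<in> S" "rep x = rep y" for x y
  proof -
    have mem: "rep y \<in> S" using rep[OF that(2)] F(2) by blast
    have "sim (rep y) y" using equivalence_onD(2)[OF eq that(2) mem] rep[OF that(2)] by blast
    moreover have "sim x (rep y)" using rep[OF that(1)] that(3) by simp
    ultimately show ?thesis using equivalence_onD(3)[OF eq that(1) mem that(2)] by blast
  qed
  let ?T = "{D. D \<subseteq> S \<and> finite D \<and> card D \<le> n}"
  define enum where "enum D = (SOME xs. set xs = D \<and> distinct xs)" for D :: "'a set"
  have enum: "set (enum D) = D \<and> distinct (enum D)" if "finite D" for D
    unfolding enum_def using finite_distinct_list[OF that] by (rule someI_ex)
  show ?thesis
  proof (rule finite_up_to_invariant[where c = "\<lambda>D. map rep (enum D)"])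
    show "equivalence_on ?T (matched sim)"
      using equivalence_on_matched[OF eq] by (rule equivalence_on_subset) auto
    have "(\<lambda>D. map rep (enum D)) ` ?T \<subseteq> {ys. set ys \<subseteq> F \<and> length ys \<le> n}"
    proof (rule image_subsetI)
      fix D assume D: "D \<in> ?T"
      then have "set (enum D) = D" "length (enum D) = card D"
        using enum[of D] distinct_card[of "enum D"] by auto
      then show "map rep (enum D) \<in> {ys. set ys \<subseteq> F \<and> length ys \<le> n}"
        using D rep by auto
    qed
    then show "finite ((\<lambda>D. map rep (enum D)) ` ?T)"
      using finite_lists_length_le[OF F(1)] by (rule finite_subset)
  next
    fix D E assume D: "D \<in> ?T" and E: "E \<in> ?T" and code: "map rep (enum D) = map rep (enum E)"
    have len: "length (enum D) = length (enum E)" using code by (metis length_map)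
    have bij: "bij_betw (\<lambda>i. enum A ! i) {..<length (enum A)} A" if "A \<in> ?T" for A
      using enum[of A] that by (intro bij_betw_nth) auto
    define pos where "pos = inv_into {..<length (enum D)} (\<lambda>i. enum D ! i)"
    have pos: "bij_betw pos D {..<length (enum D)}"
      unfolding pos_def using bij[OF D] by (rule bij_betw_inv_into)
    have nth_pos: "enum D ! pos x = x" if "x \<in> D" for x
      unfolding pos_def using bij_betw_inv_into_right[OF bij[OF D] that] .
    have "bij_betw ((\<lambda>i. enum E ! i) \<circ> pos) D E"
      using pos bij[OF E] len by (auto intro: bij_betw_trans)
    moreover have "sim x (((\<lambda>i. enum E ! i) \<circ> pos) x)" if "x \<in> D" for x
    proof -
      have i: "pos x < length (enum D)" using bij_betwE[OF pos] that by blast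
      then have "rep (enum D ! pos x) = rep (enum E ! pos x)"
        using code len by (metis nth_map)
      moreover have "enum E ! pos x \<in> E"
        using enum[of E] E i len by (metis (no_types, lifting) mem_Collect_eq nth_mem)
      ultimately show ?thesis
        using rep_eq[of x "enum E ! pos x"] nth_pos[OF that] D E that by (simp add: subset_iff)
    qed
    ultimately show "matched sim D E" unfolding matched_def by blast
  qed
qed

section \<open>Submodules and internal direct sums of two submodules\<close>

context left_module
begin

lemma smult_zero:
  assumes "a \<in> carrier R"
  shows "a \<odot>\<^bsub>M\<^esub> \<zero>\<^bsub>M\<^esub> = \<zero>\<^bsub>M\<^esub>"
proof -
  have "a \<odot>\<^bsub>M\<^esub> \<zero>\<^bsub>M\<^esub> \<oplus>\<^bsub>M\<^esub> a \<odot>\<^bsub>M\<^esub> \<zero>\<^bsub>M\<^esub> = a \<odot>\<^bsub>M\<^esub> \<zero>\<^bsub>M\<^esub> \<oplus>\<^bsub>M\<^esub> \<zero>\<^bsub>M\<^esub>"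
    using smult_r_distr[of a "\<zero>\<^bsub>M\<^esub>" "\<zero>\<^bsub>M\<^esub>"] assms by simp
  then show ?thesis using assms by simp
qed

lemma zero_smult:
  assumes "x \<in> carrier M"
  shows "\<zero> \<odot>\<^bsub>M\<^esub> x = \<zero>\<^bsub>M\<^esub>"
proof -
  have "\<zero> \<odot>\<^bsub>M\<^esub> x \<oplus>\<^bsub>M\<^esub> \<zero> \<odot>\<^bsub>M\<^esub> x = \<zero> \<odot>\<^bsub>M\<^esub> x \<oplus>\<^bsub>M\<^esub> \<zero>\<^bsub>M\<^esub>"
    using smult_l_distr[of \<zero> \<zero> x] assms by simp
  then show ?thesis using assms by simp
qed

text \<open>Through this formula, closure under scalars gives closure under negation in \<open>submoduleI\<close>.\<close>

lemma minus_one_smult: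
  assumes "x \<in> carrier M"
  shows "(\<ominus> \<one>) \<odot>\<^bsub>M\<^esub> x = \<ominus>\<^bsub>M\<^esub> x"
proof -
  have "(\<ominus> \<one>) \<odot>\<^bsub>M\<^esub> x \<oplus>\<^bsub>M\<^esub> x = (\<ominus> \<one> \<oplus> \<one>) \<odot>\<^bsub>M\<^esub> x"
    using smult_l_distr[of "\<ominus> \<one>" \<one> x] assms by simp
  then have "(\<ominus> \<one>) \<odot>\<^bsub>M\<^esub> x \<oplus>\<^bsub>M\<^esub> x = \<zero>\<^bsub>M\<^esub>"
    using assms by (simp add: R.l_neg zero_smult)
  then show ?thesis using assms by (simp add: M.minus_equality)
qed

lemma submoduleD:
  assumes "submodule N R M"
  shows submodule_subset: "N \<subseteq> carrier M"
    and submodule_zero: "\<zero>\<^bsub>M\<^esub> \<in> N"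
    and submodule_add: "\<lbrakk>x \<in> N; y \<in> N\<rbrakk> \<Longrightarrow> x \<oplus>\<^bsub>M\<^esub> y \<in> N"
    and submodule_smult: "\<lbrakk>a \<in> carrier R; x \<in> N\<rbrakk> \<Longrightarrow> a \<odot>\<^bsub>M\<^esub> x \<in> N"
    and submodule_uminus: "x \<in> N \<Longrightarrow> \<ominus>\<^bsub>M\<^esub> x \<in> N"
    and submodule_carrier: "x \<in> N \<Longrightarrow> x \<in> carrier M"
proof -
  interpret submodule N R M by fact
  show "N \<subseteq> carrier M" using subset by simp
  show "\<zero>\<^bsub>M\<^esub> \<in> N" using one_closed by simp
  show "x \<oplus>\<^bsub>M\<^esub> y \<in> N" if "x \<in> N" "y \<in> N" using m_closed that by simp
  show "a \<odot>\<^bsub>M\<^esub> x \<in> N" if "a \<in> carrier R" "x \<in> N" using smult_closed that by simp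
  show "\<ominus>\<^bsub>M\<^esub> x \<in> N" if "x \<in> N" using m_inv_closed that unfolding a_inv_def by simp
  show "x \<in> carrier M" if "x \<in> N" using subset that by auto
qed

lemma submoduleI:
  assumes "N \<subseteq> carrier M" "\<zero>\<^bsub>M\<^esub> \<in> N"
    and "\<And>x y. \<lbrakk>x \<in> N; y \<in> N\<rbrakk> \<Longrightarrow> x \<oplus>\<^bsub>M\<^esub> y \<in> N"
    and "\<And>a x. \<lbrakk>a \<in> carrier R; x \<in> N\<rbrakk> \<Longrightarrow> a \<odot>\<^bsub>M\<^esub> x \<in> N"
  shows "submodule N R M"
proof (intro submodule.intro subgroup.intro submodule_axioms.intro)
  fix x assume x: "x \<in> N"
  then have "(\<ominus> \<one>) \<odot>\<^bsub>M\<^esub> x \<in> N" using assms(4) by simp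
  then show "inv\<^bsub>add_monoid M\<^esub> x \<in> N"
    using minus_one_smult[of x] x assms(1) unfolding a_inv_def by auto
qed (use assms in simp_all)

lemma submodule_carrier_self: "submodule (carrier M) R M"
  by (rule submoduleI) simp_all

lemma left_module_restrict:
  assumes "submodule N R M"
  shows "left_module R (M\<lparr>carrier := N\<rparr>)"
proof -
  note [simp] = submodule_zero[OF assms] submodule_add[OF assms] submodule_smult[OF assms]
    submodule_carrier[OF assms]
  have "abelian_group (M\<lparr>carrier := N\<rparr>)"
  proof (rule abelian_groupI)
    fix x assume "x \<in> carrier (M\<lparr>carrier := N\<rparr>)"
    then show "\<exists>y \<in> carrier (M\<lparr>carrier := N\<rparr>). y \<oplus>\<^bsub>M\<lparr>carrier := N\<rparr>\<^esub> x = \<zero>\<^bsub>M\<lparr>carrier := N\<rparr>\<^esub>"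
      using submodule_uminus[OF assms, of x] M.l_neg[of x] by auto
  qed (simp_all add: M.a_assoc, simp add: M.a_comm)
  then show ?thesis
    by (intro left_module.intro left_module_axioms.intro R.ring_axioms)
      (simp_all add: smult_l_distr smult_r_distr smult_assoc1)
qed

lemma submodule_restrict_iff:
  assumes N: "submodule N R M"
  shows "submodule K R (M\<lparr>carrier := N\<rparr>) \<longleftrightarrow> submodule K R M \<and> K \<subseteq> N"
proof -
  interpret N: left_module R "M\<lparr>carrier := N\<rparr>" by (rule left_module_restrict[OF N])
  show ?thesis
  proof
    assume K: "submodule K R (M\<lparr>carrier := N\<rparr>)"
    note KD = N.submodule_subset[OF K] N.submodule_zero[OF K] N.submodule_add[OF K]
      N.submodule_smult[OF K]
    show "submodule K R M \<and> K \<subseteq> N"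
      using KD submodule_subset[OF N] by (auto intro!: submoduleI)
  next
    assume K: "submodule K R M \<and> K \<subseteq> N"
    then have K': "submodule K R M" by simp
    show "submodule K R (M\<lparr>carrier := N\<rparr>)"
      using K submodule_zero[OF K'] submodule_add[OF K'] submodule_smult[OF K']
      by (intro N.submoduleI) simp_all
  qed
qed

lemma finsum_restrict:
  assumes N: "submodule N R M" and x: "x \<in> D \<rightarrow> N"
  shows "finsum (M\<lparr>carrier := N\<rparr>) x D = finsum M x D"
  using x
proof (induction D rule: infinite_finite_induct)
  case (infinite D)
  interpret N: left_module R "M\<lparr>carrier := N\<rparr>" by (rule left_module_restrict[OF N])
  show ?case using infinite by (simp add: finsum_def finprod_def)
next
  case empty
  interpret N: left_module R "M\<lparr>carrier := N\<rparr>" by (rule left_module_restrict[OF N])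
  show ?case using N.M.finsum_empty M.finsum_empty by simp
next
  case (insert i D)
  interpret N: left_module R "M\<lparr>carrier := N\<rparr>" by (rule left_module_restrict[OF N])
  have x: "x i \<in> N" "x \<in> D \<rightarrow> N" using insert.prems by auto
  have xM: "x i \<in> carrier M" "x \<in> D \<rightarrow> carrier M"
    using x submodule_carrier[OF N] by auto
  show ?case
    using N.M.finsum_insert[of D i x] M.finsum_insert[of D i x] insert.hyps insert.IH x xM by simp
qed

lemma finsum_submodule:
  assumes N: "submodule N R M" and x: "x \<in> D \<rightarrow> N"
  shows "finsum M x D \<in> N"
proof -
  interpret N: left_module R "M\<lparr>carrier := N\<rparr>" by (rule left_module_restrict[OF N])
  show ?thesis using N.M.finsum_closed[of x D] x finsum_restrict[OF N x] by simp
qed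

lemma finsum_smult:
  assumes a: "a \<in> carrier R" and x: "x \<in> D \<rightarrow> carrier M"
  shows "finsum M (\<lambda>i. a \<odot>\<^bsub>M\<^esub> x i) D = a \<odot>\<^bsub>M\<^esub> finsum M x D"
  using x
proof (induction D rule: infinite_finite_induct)
  case (infinite D)
  then show ?case using a by (simp add: finsum_def finprod_def smult_zero)
next
  case empty
  then show ?case using a M.finsum_empty by (simp add: smult_zero)
next
  case (insert i D)
  have x: "x i \<in> carrier M" "x \<in> D \<rightarrow> carrier M" using insert.prems by auto
  then have ax: "(\<lambda>i. a \<odot>\<^bsub>M\<^esub> x i) \<in> D \<rightarrow> carrier M" using a by auto
  show ?case
    using M.finsum_insert[of D i x] M.finsum_insert[of D i "\<lambda>i. a \<odot>\<^bsub>M\<^esub> x i"] insert.hyps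
      insert.IH x ax a by (simp add: smult_r_distr)
qed

text \<open>\<open>L\<close> is the internal direct sum of \<open>A\<close> and \<open>B\<close>. Unlike \<open>complementary_submodules\<close> in the module
  \<open>M\<lparr>carrier := L\<rparr>\<close>, the predicate refers to the one ambient module \<open>M\<close> for every \<open>L\<close>, so that
  decompositions of different submodules can be combined without changing the module.\<close>

definition splits :: "'m set \<Rightarrow> 'm set \<Rightarrow> 'm set \<Rightarrow> bool"
  where "splits L A B \<longleftrightarrow>
    submodule A R M \<and> submodule B R M \<and> A \<inter> B = {\<zero>\<^bsub>M\<^esub>} \<and> A <+>\<^bsub>M\<^esub> B = L"

lemma set_add_iff: "m \<in> A <+>\<^bsub>M\<^esub> B \<longleftrightarrow> (\<exists>a \<in> A. \<exists>b \<in> B. m = a \<oplus>\<^bsub>M\<^esub> b)"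
  unfolding set_add_def set_mult_def by simp

lemma set_add_restrict: "A <+>\<^bsub>M\<lparr>carrier := N\<rparr>\<^esub> B = A <+>\<^bsub>M\<^esub> B"
  unfolding set_add_def set_mult_def by simp

lemma minus_eq_zeroD:
  assumes "x \<in> carrier M" "y \<in> carrier M" "x \<ominus>\<^bsub>M\<^esub> y = \<zero>\<^bsub>M\<^esub>"
  shows "x = y"
proof -
  have "(x \<ominus>\<^bsub>M\<^esub> y) \<oplus>\<^bsub>M\<^esub> y = x"
    using assms(1,2) by (simp add: a_minus_def M.a_assoc M.l_neg)
  then show ?thesis using assms by simp
qed

lemma splits_add_eq_iff:
  assumes "splits L A B" and m: "a \<in> A" "a' \<in> A" "b \<in> B" "b' \<in> B"
  shows "a \<oplus>\<^bsub>M\<^esub> b = a' \<oplus>\<^bsub>M\<^esub> b' \<longleftrightarrow> a = a' \<and> b = b'"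
proof
  have A: "submodule A R M" and B: "submodule B R M" and int: "A \<inter> B = {\<zero>\<^bsub>M\<^esub>}"
    using assms(1) unfolding splits_def by auto
  note c[simp] = submodule_carrier[OF A m(1)] submodule_carrier[OF A m(2)]
    submodule_carrier[OF B m(3)] submodule_carrier[OF B m(4)]
  assume eq: "a \<oplus>\<^bsub>M\<^esub> b = a' \<oplus>\<^bsub>M\<^esub> b'"
  have "a \<ominus>\<^bsub>M\<^esub> a' = (a \<oplus>\<^bsub>M\<^esub> b) \<oplus>\<^bsub>M\<^esub> (\<ominus>\<^bsub>M\<^esub> b \<oplus>\<^bsub>M\<^esub> \<ominus>\<^bsub>M\<^esub> a')"
    by (simp add: a_minus_def M.a_assoc M.r_neg2)
  also have "\<dots> = (a' \<oplus>\<^bsub>M\<^esub> b') \<oplus>\<^bsub>M\<^esub> (\<ominus>\<^bsub>M\<^esub> a' \<oplus>\<^bsub>M\<^esub> \<ominus>\<^bsub>M\<^esub> b)"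
    unfolding eq by (simp add: M.a_comm)
  also have "\<dots> = (b' \<oplus>\<^bsub>M\<^esub> a') \<oplus>\<^bsub>M\<^esub> (\<ominus>\<^bsub>M\<^esub> a' \<oplus>\<^bsub>M\<^esub> \<ominus>\<^bsub>M\<^esub> b)"
    by (simp add: M.a_comm)
  also have "\<dots> = b' \<ominus>\<^bsub>M\<^esub> b"
    by (simp add: a_minus_def M.a_assoc M.r_neg2)
  finally have d: "a \<ominus>\<^bsub>M\<^esub> a' = b' \<ominus>\<^bsub>M\<^esub> b" .
  have "a \<ominus>\<^bsub>M\<^esub> a' \<in> A" "b' \<ominus>\<^bsub>M\<^esub> b \<in> B"
    unfolding a_minus_def using m submodule_add[OF A] submodule_add[OF B]
      submodule_uminus[OF A] submodule_uminus[OF B] by auto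
  then have "a \<ominus>\<^bsub>M\<^esub> a' = \<zero>\<^bsub>M\<^esub>" "b' \<ominus>\<^bsub>M\<^esub> b = \<zero>\<^bsub>M\<^esub>"
    using d int by auto
  then show "a = a' \<and> b = b'"
    using minus_eq_zeroD[of a a'] minus_eq_zeroD[of b' b] by simp
qed simp

lemma splits_submodule:
  assumes "splits L A B"
  shows "submodule L R M" "submodule A R M" "submodule B R M" "A \<subseteq> L" "B \<subseteq> L"
proof -
  show A: "submodule A R M" and B: "submodule B R M" using assms unfolding splits_def by auto
  have L: "m \<in> L \<longleftrightarrow> (\<exists>a \<in> A. \<exists>b \<in> B. m = a \<oplus>\<^bsub>M\<^esub> b)" for m
    using assms set_add_iff[of m A B] unfolding splits_def by simp
  note [simp] = submodule_carrier[OF A] submodule_carrier[OF B] submodule_zero[OF A]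
    submodule_zero[OF B]
  show "A \<subseteq> L"
  proof
    fix a assume "a \<in> A"
    then show "a \<in> L" unfolding L by (intro bexI[of _ a] bexI[of _ "\<zero>\<^bsub>M\<^esub>"]) simp_all
  qed
  show "B \<subseteq> L"
  proof
    fix b assume "b \<in> B"
    then show "b \<in> L" unfolding L by (intro bexI[of _ b] bexI[of _ "\<zero>\<^bsub>M\<^esub>"]) simp_all
  qed
  show "submodule L R M"
  proof (rule submoduleI)
    show "L \<subseteq> carrier M" using L by auto
    show "\<zero>\<^bsub>M\<^esub> \<in> L" using \<open>A \<subseteq> L\<close> submodule_zero[OF A] by auto
    fix x y assume "x \<in> L" "y \<in> L"
    then obtain a b a' b' where ab: "a \<in> A" "b \<in> B" "a' \<in> A" "b' \<in> B"
      "x = a \<oplus>\<^bsub>M\<^esub> b" "y = a' \<oplus>\<^bsub>M\<^esub> b'" unfolding L by auto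
    then have "x \<oplus>\<^bsub>M\<^esub> y = (a \<oplus>\<^bsub>M\<^esub> a') \<oplus>\<^bsub>M\<^esub> (b \<oplus>\<^bsub>M\<^esub> b')"
      by (simp add: M.a_ac)
    moreover have "a \<oplus>\<^bsub>M\<^esub> a' \<in> A" "b \<oplus>\<^bsub>M\<^esub> b' \<in> B"
      using ab submodule_add[OF A] submodule_add[OF B] by auto
    ultimately show "x \<oplus>\<^bsub>M\<^esub> y \<in> L" unfolding L by auto
  next
    fix r x assume r: "r \<in> carrier R" and "x \<in> L"
    then obtain a b where ab: "a \<in> A" "b \<in> B" "x = a \<oplus>\<^bsub>M\<^esub> b" unfolding L by auto
    then have "r \<odot>\<^bsub>M\<^esub> x = r \<odot>\<^bsub>M\<^esub> a \<oplus>\<^bsub>M\<^esub> r \<odot>\<^bsub>M\<^esub> b" using r by (simp add: smult_r_distr)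
    moreover have "r \<odot>\<^bsub>M\<^esub> a \<in> A" "r \<odot>\<^bsub>M\<^esub> b \<in> B"
      using ab r submodule_smult[OF A] submodule_smult[OF B] by auto
    ultimately show "r \<odot>\<^bsub>M\<^esub> x \<in> L" unfolding L by auto
  qed
qed

lemma splitsE:
  assumes "splits L A B" "m \<in> L"
  obtains a b where "a \<in> A" "b \<in> B" "m = a \<oplus>\<^bsub>M\<^esub> b"
  using assms set_add_iff[of m A B] unfolding splits_def by auto

lemma splits_addI:
  assumes "splits L A B" "a \<in> A" "b \<in> B"
  shows "a \<oplus>\<^bsub>M\<^esub> b \<in> L"
  using assms set_add_iff[of "a \<oplus>\<^bsub>M\<^esub> b" A B] unfolding splits_def by auto

lemma splits_commute:
  assumes "splits L A B"
  shows "splits L B A"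
proof -
  note s = splits_submodule[OF assms]
  have "B <+>\<^bsub>M\<^esub> A = A <+>\<^bsub>M\<^esub> B"
    using M.a_comm[OF submodule_carrier[OF s(3)] submodule_carrier[OF s(2)]]
    by (auto simp: set_eq_iff set_add_iff) metis+
  then show ?thesis using assms unfolding splits_def by (simp add: Int_commute)
qed

lemma complementary_submodules_iff_splits:
  assumes "submodule L R M"
  shows "complementary_submodules R (M\<lparr>carrier := L\<rparr>) A B \<longleftrightarrow> splits L A B"
proof
  assume "complementary_submodules R (M\<lparr>carrier := L\<rparr>) A B"
  then show "splits L A B"
    unfolding complementary_submodules_def splits_def submodule_restrict_iff[OF assms]
      set_add_restrict by simp
next
  assume s: "splits L A B"
  then show "complementary_submodules R (M\<lparr>carrier := L\<rparr>) A B"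
    using splits_submodule[OF s]
    unfolding complementary_submodules_def splits_def submodule_restrict_iff[OF assms]
      set_add_restrict by simp
qed

lemma complementary_submodules_iff_splits_carrier:
  "complementary_submodules R M A B \<longleftrightarrow> splits (carrier M) A B"
  unfolding complementary_submodules_def splits_def ..

text \<open>Refining the summand \<open>N\<close> of \<open>L\<close>: from \<open>L = N \<oplus> K\<close> and \<open>N = A \<oplus> B\<close> follows
  \<open>L = A \<oplus> (B \<oplus> K)\<close>. An element of \<open>A\<close> that equals \<open>b + k\<close> lies in \<open>N\<close>, so uniqueness in \<open>N \<oplus> K\<close>
  makes it equal to \<open>b\<close>, and \<open>A\<close> meets \<open>B\<close> only in zero.\<close>

lemma splits_assoc:
  assumes L: "splits L N K" and N: "splits N A B"
  shows "splits (B <+>\<^bsub>M\<^esub> K) B K" "splits L A (B <+>\<^bsub>M\<^esub> K)"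
proof -
  note l = splits_submodule[OF L] and n = splits_submodule[OF N]
  note [simp] = submodule_carrier[OF n(2)] submodule_carrier[OF n(3)] submodule_carrier[OF l(3)]
  have "B \<inter> K = {\<zero>\<^bsub>M\<^esub>}"
    using L n(5) submodule_zero[OF n(3)] submodule_zero[OF l(3)] unfolding splits_def by auto
  then show BK: "splits (B <+>\<^bsub>M\<^esub> K) B K" using n(3) l(3) unfolding splits_def by simp
  note bk = splits_submodule[OF BK]
  have "A \<inter> (B <+>\<^bsub>M\<^esub> K) \<subseteq> {\<zero>\<^bsub>M\<^esub>}"
  proof
    fix m assume m: "m \<in> A \<inter> (B <+>\<^bsub>M\<^esub> K)"
    then obtain b k where bk: "b \<in> B" "k \<in> K" "m = b \<oplus>\<^bsub>M\<^esub> k" using set_add_iff[of m B K] by auto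
    have "m \<oplus>\<^bsub>M\<^esub> \<zero>\<^bsub>M\<^esub> = b \<oplus>\<^bsub>M\<^esub> k" using m bk by simp
    then have "m = b"
      using splits_add_eq_iff[OF L, of m b "\<zero>\<^bsub>M\<^esub>" k] m bk n(4,5) submodule_zero[OF l(3)] by auto
    then show "m \<in> {\<zero>\<^bsub>M\<^esub>}" using m bk(1) N unfolding splits_def by auto
  qed
  then have int: "A \<inter> (B <+>\<^bsub>M\<^esub> K) = {\<zero>\<^bsub>M\<^esub>}"
    using submodule_zero[OF n(2)] submodule_zero[OF bk(1)] by auto
  have "A <+>\<^bsub>M\<^esub> (B <+>\<^bsub>M\<^esub> K) = (A <+>\<^bsub>M\<^esub> B) <+>\<^bsub>M\<^esub> K"
    using M.add.set_mult_assoc submodule_subset[OF n(2)] submodule_subset[OF n(3)]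
      submodule_subset[OF l(3)] unfolding set_add_def by simp
  also have "\<dots> = L" using L N unfolding splits_def by simp
  finally show "splits L A (B <+>\<^bsub>M\<^esub> K)" using n(2) bk(1) int unfolding splits_def by simp
qed

section \<open>Adding a summand to a finite decomposition\<close>

text \<open>Over a finite index set every support is finite, and adding the zero components to a sum over the
  support gives the sum over all indices.\<close>

lemma direct_decompositions_finite_iff:
  assumes "finite D"
  shows "D \<in> direct_decompositions R M \<longleftrightarrow>
    (\<forall>N \<in> D. submodule N R M \<and> N \<noteq> {\<zero>\<^bsub>M\<^esub>}) \<and>
    (\<forall>m \<in> carrier M. \<exists>!x. x \<in> (\<Pi>\<^sub>E N\<in>D. N) \<and> m = finsum M x D)"
proof (cases "\<forall>N \<in> D. submodule N R M \<and> N \<noteq> {\<zero>\<^bsub>M\<^esub>}")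
  case True
  have supp: "finsum M x {N \<in> D. x N \<noteq> \<zero>\<^bsub>M\<^esub>} = finsum M x D" if "x \<in> (\<Pi>\<^sub>E N\<in>D. N)" for x
  proof (rule M.add.finprod_mono_neutral_cong_left)
    show "x \<in> D \<rightarrow> carrier M"
      using that True submodule_carrier by (auto simp: PiE_iff)
  qed (use assms in auto)
  have "x \<in> (\<Pi>\<^sub>E N\<in>D. N) \<and> finite {N \<in> D. x N \<noteq> \<zero>\<^bsub>M\<^esub>} \<and>
      m = finsum M x {N \<in> D. x N \<noteq> \<zero>\<^bsub>M\<^esub>} \<longleftrightarrow> x \<in> (\<Pi>\<^sub>E N\<in>D. N) \<and> m = finsum M x D" for x m
    using supp[of x] assms by auto
  then show ?thesis
    using True unfolding direct_decompositions_def direct_sum_family_def by simp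
next
  case False
  then show ?thesis unfolding direct_decompositions_def direct_sum_family_def by auto
qed

text \<open>Writing \<open>m = a + k\<close> and expanding \<open>k\<close> along \<open>D\<close> gives the expansion of \<open>m\<close>. It is unique because
  both steps are: the tail of any expansion sums to an element of \<open>K\<close>.\<close>

lemma insert_decompositionI:
  assumes fin: "finite D" and N: "N \<noteq> {\<zero>\<^bsub>M\<^esub>}"
    and split: "splits (carrier M) N K"
    and D: "D \<in> direct_decompositions R (M\<lparr>carrier := K\<rparr>)"
  shows "N \<notin> D" "insert N D \<in> direct_decompositions R M"
proof -
  note s = splits_submodule[OF split]
  interpret K: left_module R "M\<lparr>carrier := K\<rparr>" by (rule left_module_restrict[OF s(3)])
  have D1: "\<And>A. A \<in> D \<Longrightarrow> submodule A R M \<and> A \<subseteq> K \<and> A \<noteq> {\<zero>\<^bsub>M\<^esub>}"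
    using D unfolding K.direct_decompositions_finite_iff[OF fin] submodule_restrict_iff[OF s(3)]
    by simp
  have D2: "\<And>k. k \<in> K \<Longrightarrow>
      \<exists>!x. x \<in> (\<Pi>\<^sub>E A\<in>D. A) \<and> k = finsum (M\<lparr>carrier := K\<rparr>) x D"
    using D unfolding K.direct_decompositions_finite_iff[OF fin] by simp
  have inK: "x \<in> D \<rightarrow> K" if "x \<in> (\<Pi>\<^sub>E A\<in>D. A)" for x
    using that D1 by (auto simp: PiE_iff)
  show ND: "N \<notin> D"
  proof
    assume "N \<in> D"
    then have "N = {\<zero>\<^bsub>M\<^esub>}" using D1[of N] split unfolding splits_def by auto
    then show False using N by simp
  qed
  have sum: "finsum M x (insert N D) = x N \<oplus>\<^bsub>M\<^esub> finsum M (restrict x D) D"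
      "x N \<in> N" "restrict x D \<in> (\<Pi>\<^sub>E A\<in>D. A)" "finsum M (restrict x D) D \<in> K"
      "finsum (M\<lparr>carrier := K\<rparr>) (restrict x D) D = finsum M (restrict x D) D"
    if x: "x \<in> (\<Pi>\<^sub>E A\<in>insert N D. A)" for x
  proof -
    show xN: "x N \<in> N" and r: "restrict x D \<in> (\<Pi>\<^sub>E A\<in>D. A)" using x by (auto simp: PiE_iff)
    have "x A \<in> carrier M" if "A \<in> D" for A
      using x that D1[OF that] submodule_carrier[of A "x A"] by (auto simp: PiE_iff)
    then have "x \<in> D \<rightarrow> carrier M" by simp
    moreover from this have "finsum M (restrict x D) D = finsum M x D"
      by (intro M.finsum_cong') auto
    ultimately show "finsum M x (insert N D) = x N \<oplus>\<^bsub>M\<^esub> finsum M (restrict x D) D"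
      using M.finsum_insert[OF fin ND, of x] submodule_carrier[OF s(2) xN] by simp
    show "finsum M (restrict x D) D \<in> K"
      using finsum_submodule[OF s(3) inK[OF r]] .
    show "finsum (M\<lparr>carrier := K\<rparr>) (restrict x D) D = finsum M (restrict x D) D"
      using finsum_restrict[OF s(3) inK[OF r]] .
  qed
  have "\<exists>!x. x \<in> (\<Pi>\<^sub>E A\<in>insert N D. A) \<and> m = finsum M x (insert N D)"
    if m: "m \<in> carrier M" for m
  proof -
    obtain a k where ak: "a \<in> N" "k \<in> K" "m = a \<oplus>\<^bsub>M\<^esub> k" using splitsE[OF split m] .
    obtain y where y: "y \<in> (\<Pi>\<^sub>E A\<in>D. A)" "k = finsum (M\<lparr>carrier := K\<rparr>) y D"
      using ex1_implies_ex[OF D2[OF ak(2)]] by auto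
    define x where "x = y(N := a)"
    have x: "x \<in> (\<Pi>\<^sub>E A\<in>insert N D. A)"
      using y(1) ak(1) unfolding x_def by (auto simp: PiE_iff extensional_def)
    have res: "restrict x D = y"
      using y(1) ND unfolding x_def
      by (auto simp: PiE_iff extensional_def restrict_def fun_eq_iff)
    have mx: "m = finsum M x (insert N D)"
      using sum[OF x] y(2) ak(3) unfolding res by (simp add: x_def)
    have "z = x" if z: "z \<in> (\<Pi>\<^sub>E A\<in>insert N D. A)" "m = finsum M z (insert N D)" for z
    proof -
      have "z N \<oplus>\<^bsub>M\<^esub> finsum M (restrict z D) D = x N \<oplus>\<^bsub>M\<^esub> finsum M (restrict x D) D"
        using z(2) mx sum(1)[OF x] sum(1)[OF z(1)] by simp
      then have eq: "z N = x N" "finsum M (restrict z D) D = finsum M (restrict x D) D"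
        using splits_add_eq_iff[OF split sum(2)[OF z(1)] sum(2)[OF x] sum(4)[OF z(1)] sum(4)[OF x]]
        by auto
      then have "restrict z D = restrict x D"
        using D2[OF sum(4)[OF x]] sum(3,5)[OF z(1)] sum(3,5)[OF x] by (metis (no_types, lifting))
      then have "z A = x A" if "A \<in> D" for A
        using that by (metis restrict_apply')
      then show ?thesis
        using eq(1) z(1) x by (intro PiE_ext[OF z(1) x]) auto
    qed
    then show ?thesis using x mx by (intro ex1I[of _ x]) auto
  qed
  then show "insert N D \<in> direct_decompositions R M"
    using D1 N s(2) fin by (subst direct_decompositions_finite_iff) auto
qed

text \<open>The complement of \<open>N\<close> is the set \<open>K\<close> of all sums of expansions along \<open>D\<close>. Extending an expansion
  by a component in \<open>N\<close> is injective by uniqueness for \<open>insert N D\<close>; this one fact gives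
  both that \<open>K\<close> meets \<open>N\<close> trivially and that expansions along \<open>D\<close> are unique.\<close>

lemma insert_decompositionE:
  assumes fin: "finite D" and ND: "N \<notin> D" and dec: "insert N D \<in> direct_decompositions R M"
  obtains K where "N \<noteq> {\<zero>\<^bsub>M\<^esub>}" "splits (carrier M) N K"
    "D \<in> direct_decompositions R (M\<lparr>carrier := K\<rparr>)"
proof
  have fin': "finite (insert N D)" using fin by simp
  have mem: "submodule A R M \<and> A \<noteq> {\<zero>\<^bsub>M\<^esub>}" if "A \<in> insert N D" for A
    using bspec[OF conjunct1[OF dec[unfolded direct_decompositions_finite_iff[OF fin']]] that] .
  have rep: "\<And>m. m \<in> carrier M \<Longrightarrow>
      \<exists>!x. x \<in> (\<Pi>\<^sub>E A\<in>insert N D. A) \<and> m = finsum M x (insert N D)"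
    using dec unfolding direct_decompositions_finite_iff[OF fin'] by simp
  have uniq: "x = y" if "x \<in> (\<Pi>\<^sub>E A\<in>insert N D. A)" "y \<in> (\<Pi>\<^sub>E A\<in>insert N D. A)"
    "finsum M x (insert N D) = finsum M y (insert N D)" for x y
  proof -
    have "x \<in> insert N D \<rightarrow> carrier M"
      using that(1) mem submodule_carrier by (auto simp: PiE_iff)
    then have "finsum M x (insert N D) \<in> carrier M" by (rule M.finsum_closed)
    from rep[OF this] show ?thesis using that by (metis (no_types, lifting))
  qed
  have N: "submodule N R M" using mem by simp
  show "N \<noteq> {\<zero>\<^bsub>M\<^esub>}" using mem by simp
  have Dc: "y \<in> D \<rightarrow> carrier M" if "y \<in> (\<Pi>\<^sub>E A\<in>D. A)" for y
    using that mem submodule_carrier by (auto simp: PiE_iff)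
  define K where "K = (\<lambda>y. finsum M y D) ` (\<Pi>\<^sub>E A\<in>D. A)"
  have KI: "finsum M y D \<in> K" if "y \<in> (\<Pi>\<^sub>E A\<in>D. A)" for y
    unfolding K_def using that by (rule imageI)
  have extend: "y(N := a) \<in> (\<Pi>\<^sub>E A\<in>insert N D. A)"
      "finsum M (y(N := a)) (insert N D) = a \<oplus>\<^bsub>M\<^esub> finsum M y D"
    if y: "y \<in> (\<Pi>\<^sub>E A\<in>D. A)" and a: "a \<in> N" for y a
  proof -
    show "y(N := a) \<in> (\<Pi>\<^sub>E A\<in>insert N D. A)"
      using y a by (auto simp: PiE_iff extensional_def)
    have "finsum M (y(N := a)) D = finsum M y D"
      using Dc[OF y] ND by (intro M.finsum_cong') auto
    moreover have "y(N := a) \<in> D \<rightarrow> carrier M" using Dc[OF y] ND by auto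
    ultimately show "finsum M (y(N := a)) (insert N D) = a \<oplus>\<^bsub>M\<^esub> finsum M y D"
      using M.finsum_insert[OF fin ND, of "y(N := a)"] submodule_carrier[OF N a] by simp
  qed
  have extend_inj: "y = z \<and> a = b"
    if "y \<in> (\<Pi>\<^sub>E A\<in>D. A)" "z \<in> (\<Pi>\<^sub>E A\<in>D. A)" "a \<in> N" "b \<in> N"
      "a \<oplus>\<^bsub>M\<^esub> finsum M y D = b \<oplus>\<^bsub>M\<^esub> finsum M z D" for y z a b
  proof -
    have eq: "y(N := a) = z(N := b)"
      using uniq[OF extend(1)[OF that(1,3)] extend(1)[OF that(2,4)]]
        extend(2)[OF that(1,3)] extend(2)[OF that(2,4)] that(5) by simp
    have "y A = z A" if "A \<in> D" for A
      using fun_cong[OF eq, of A] ND that by (auto split: if_splits)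
    then show ?thesis using PiE_ext[OF that(1,2)] fun_cong[OF eq, of N] by simp
  qed
  have zero: "(\<lambda>A\<in>D. \<zero>\<^bsub>M\<^esub>) \<in> (\<Pi>\<^sub>E A\<in>D. A)" "finsum M (\<lambda>A\<in>D. \<zero>\<^bsub>M\<^esub>) D = \<zero>\<^bsub>M\<^esub>"
  proof -
    show "(\<lambda>A\<in>D. \<zero>\<^bsub>M\<^esub>) \<in> (\<Pi>\<^sub>E A\<in>D. A)" using mem submodule_zero by auto
    have "finsum M (\<lambda>A\<in>D. \<zero>\<^bsub>M\<^esub>) D = finsum M (\<lambda>A. \<zero>\<^bsub>M\<^esub>) D"
      by (intro M.finsum_cong') auto
    then show "finsum M (\<lambda>A\<in>D. \<zero>\<^bsub>M\<^esub>) D = \<zero>\<^bsub>M\<^esub>" using M.finsum_zero by simp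
  qed
  have K: "submodule K R M"
  proof (rule submoduleI)
    show "K \<subseteq> carrier M" unfolding K_def using M.finsum_closed[OF Dc] by auto
    show "\<zero>\<^bsub>M\<^esub> \<in> K" using KI[OF zero(1)] zero(2) by simp
    fix k l assume "k \<in> K" "l \<in> K"
    then obtain y z where yz: "y \<in> (\<Pi>\<^sub>E A\<in>D. A)" "k = finsum M y D"
      "z \<in> (\<Pi>\<^sub>E A\<in>D. A)" "l = finsum M z D" unfolding K_def by auto
    define w where "w = (\<lambda>A\<in>D. y A \<oplus>\<^bsub>M\<^esub> z A)"
    have "w \<in> (\<Pi>\<^sub>E A\<in>D. A)"
      using yz(1,3) mem submodule_add unfolding w_def by (auto simp: PiE_iff)
    moreover have "finsum M w D = finsum M (\<lambda>A. y A \<oplus>\<^bsub>M\<^esub> z A) D"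
      using Dc[OF yz(1)] Dc[OF yz(3)] unfolding w_def by (intro M.finsum_cong') auto
    moreover have "\<dots> = k \<oplus>\<^bsub>M\<^esub> l"
      using M.finsum_addf[OF Dc[OF yz(1)] Dc[OF yz(3)]] yz(2,4) by simp
    ultimately show "k \<oplus>\<^bsub>M\<^esub> l \<in> K" using KI[of w] by simp
  next
    fix r k assume r: "r \<in> carrier R" and "k \<in> K"
    then obtain y where y: "y \<in> (\<Pi>\<^sub>E A\<in>D. A)" "k = finsum M y D" unfolding K_def by auto
    define w where "w = (\<lambda>A\<in>D. r \<odot>\<^bsub>M\<^esub> y A)"
    have "w \<in> (\<Pi>\<^sub>E A\<in>D. A)"
      using y(1) mem submodule_smult[OF _ r] unfolding w_def by (auto simp: PiE_iff)
    moreover have "finsum M w D = finsum M (\<lambda>A. r \<odot>\<^bsub>M\<^esub> y A) D"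
      using Dc[OF y(1)] r unfolding w_def by (intro M.finsum_cong') auto
    moreover have "\<dots> = r \<odot>\<^bsub>M\<^esub> k"
      using finsum_smult[OF r Dc[OF y(1)]] y(2) by simp
    ultimately show "r \<odot>\<^bsub>M\<^esub> k \<in> K" using KI[of w] by simp
  qed
  interpret K: left_module R "M\<lparr>carrier := K\<rparr>" by (rule left_module_restrict[OF K])
  \<comment> \<open>A common element expands both as itself plus zero and as zero plus an element of \<open>K\<close>.\<close>
  have "N \<inter> K \<subseteq> {\<zero>\<^bsub>M\<^esub>}"
  proof
    fix m assume m: "m \<in> N \<inter> K"
    then obtain y where y: "y \<in> (\<Pi>\<^sub>E A\<in>D. A)" "m = finsum M y D" unfolding K_def by auto
    have "m \<oplus>\<^bsub>M\<^esub> finsum M (\<lambda>A\<in>D. \<zero>\<^bsub>M\<^esub>) D = \<zero>\<^bsub>M\<^esub> \<oplus>\<^bsub>M\<^esub> finsum M y D"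
      using zero(2) y m submodule_carrier[OF N, of m] by simp
    then show "m \<in> {\<zero>\<^bsub>M\<^esub>}"
      using extend_inj[OF zero(1) y(1), of m "\<zero>\<^bsub>M\<^esub>"] m submodule_zero[OF N] by simp
  qed
  then have int: "N \<inter> K = {\<zero>\<^bsub>M\<^esub>}" using submodule_zero[OF N] submodule_zero[OF K] by auto
  have "\<exists>a \<in> N. \<exists>k \<in> K. m = a \<oplus>\<^bsub>M\<^esub> k" if m: "m \<in> carrier M" for m
  proof -
    obtain x where x: "x \<in> (\<Pi>\<^sub>E A\<in>insert N D. A)" "m = finsum M x (insert N D)"
      using ex1_implies_ex[OF rep[OF m]] by auto
    have r: "restrict x D \<in> (\<Pi>\<^sub>E A\<in>D. A)" and a: "x N \<in> N" using x by (auto simp: PiE_iff)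
    have "(restrict x D)(N := x N) = x"
      using x(1) by (auto simp: PiE_iff extensional_def restrict_def fun_eq_iff)
    then have "m = x N \<oplus>\<^bsub>M\<^esub> finsum M (restrict x D) D" using extend(2)[OF r a] x(2) by simp
    then show ?thesis by (rule bexI[OF bexI[OF _ KI[OF r]] a])
  qed
  moreover have "a \<oplus>\<^bsub>M\<^esub> k \<in> carrier M" if "a \<in> N" "k \<in> K" for a k
    using submodule_carrier[OF N that(1)] submodule_carrier[OF K that(2)] by simp
  ultimately have "N <+>\<^bsub>M\<^esub> K = carrier M"
    by (auto simp: set_eq_iff set_add_iff)
  then show "splits (carrier M) N K" using N K int unfolding splits_def by simp
  have AK: "A \<subseteq> K" if A: "A \<in> D" for A
  proof
    fix a assume a: "a \<in> A"
    have ac: "a \<in> carrier M" using mem A a submodule_carrier by auto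
    \<comment> \<open>An element of a member is the sum of the expansion concentrated there.\<close>
    define y where "y = (\<lambda>B\<in>D. if A = B then a else \<zero>\<^bsub>M\<^esub>)"
    have "y \<in> (\<Pi>\<^sub>E A\<in>D. A)"
      using a A mem submodule_zero unfolding y_def by auto
    moreover have "finsum M y D = finsum M (\<lambda>B. if A = B then a else \<zero>\<^bsub>M\<^esub>) D"
      using ac unfolding y_def by (intro M.finsum_cong') auto
    moreover have "\<dots> = a"
      using M.add.finprod_singleton[OF A fin, of "\<lambda>_. a"] ac by auto
    ultimately show "a \<in> K" using KI[of y] by simp
  qed
  have "\<exists>!y. y \<in> (\<Pi>\<^sub>E A\<in>D. A) \<and> k = finsum (M\<lparr>carrier := K\<rparr>) y D" if k: "k \<in> K" for k
  proof -
    have fK: "finsum (M\<lparr>carrier := K\<rparr>) y D = finsum M y D" if "y \<in> (\<Pi>\<^sub>E A\<in>D. A)" for y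
      using that AK by (intro finsum_restrict[OF K]) (auto simp: PiE_iff)
    obtain y where y: "y \<in> (\<Pi>\<^sub>E A\<in>D. A)" "k = finsum M y D" using k unfolding K_def by auto
    have "z = y" if z: "z \<in> (\<Pi>\<^sub>E A\<in>D. A)" "k = finsum M z D" for z
      using extend_inj[OF z(1) y(1) submodule_zero[OF N] submodule_zero[OF N]] y(2) z(2) by simp
    then show ?thesis using y fK by (intro ex1I[of _ y]) auto
  qed
  then show "D \<in> direct_decompositions R (M\<lparr>carrier := K\<rparr>)"
    using mem AK submodule_restrict_iff[OF K]
    by (subst K.direct_decompositions_finite_iff[OF fin]) auto
qed

section \<open>Isomorphism of submodules\<close>

lemma submodule_isomorphic_iff:
  "submodule_isomorphic R M N K \<longleftrightarrow>
    (\<exists>f. bij_betw f N K \<and> (\<forall>x \<in> N. \<forall>y \<in> N. f (x \<oplus>\<^bsub>M\<^esub> y) = f x \<oplus>\<^bsub>M\<^esub> f y) \<and>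
      (\<forall>a \<in> carrier R. \<forall>x \<in> N. f (a \<odot>\<^bsub>M\<^esub> x) = a \<odot>\<^bsub>M\<^esub> f x))"
  unfolding submodule_isomorphic_def module_isomorphic_def iso_def hom_def
  by (auto dest: bij_betwE)

lemma equivalence_on_submodule_isomorphic:
  "equivalence_on {N. submodule N R M} (submodule_isomorphic R M)"
proof -
  have refl: "submodule_isomorphic R M N N" for N
    unfolding submodule_isomorphic_iff by (intro exI[of _ id]) simp
  have sym: "submodule_isomorphic R M K N"
    if NK: "submodule N R M" "submodule K R M" "submodule_isomorphic R M N K" for N K
  proof -
    obtain f where f: "bij_betw f N K"
      "\<And>x y. \<lbrakk>x \<in> N; y \<in> N\<rbrakk> \<Longrightarrow> f (x \<oplus>\<^bsub>M\<^esub> y) = f x \<oplus>\<^bsub>M\<^esub> f y"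
      "\<And>a x. \<lbrakk>a \<in> carrier R; x \<in> N\<rbrakk> \<Longrightarrow> f (a \<odot>\<^bsub>M\<^esub> x) = a \<odot>\<^bsub>M\<^esub> f x"
      using NK(3) unfolding submodule_isomorphic_iff by auto
    define g where "g = inv_into N f"
    have g: "bij_betw g K N" unfolding g_def using f(1) by (rule bij_betw_inv_into)
    have gN: "g y \<in> N" if "y \<in> K" for y using bij_betwE[OF g] that by simp
    have fg: "f (g y) = y" if "y \<in> K" for y
      unfolding g_def using bij_betw_inv_into_right[OF f(1) that] .
    have gf: "g (f x) = x" if "x \<in> N" for x
      unfolding g_def using bij_betw_inv_into_left[OF f(1) that] .
    have "g (x \<oplus>\<^bsub>M\<^esub> y) = g x \<oplus>\<^bsub>M\<^esub> g y" if "x \<in> K" "y \<in> K" for x y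
      using gf[of "g x \<oplus>\<^bsub>M\<^esub> g y"] f(2)[of "g x" "g y"] fg gN submodule_add[OF NK(1)] that by simp
    moreover have "g (a \<odot>\<^bsub>M\<^esub> x) = a \<odot>\<^bsub>M\<^esub> g x" if "a \<in> carrier R" "x \<in> K" for a x
      using gf[of "a \<odot>\<^bsub>M\<^esub> g x"] f(3)[of a "g x"] fg gN submodule_smult[OF NK(1)] that by simp
    ultimately show ?thesis unfolding submodule_isomorphic_iff using g by auto
  qed
  have trans: "submodule_isomorphic R M N L"
    if NK: "submodule_isomorphic R M N K" and KL: "submodule_isomorphic R M K L" for N K L
  proof -
    obtain f where f: "bij_betw f N K"
      "\<And>x y. \<lbrakk>x \<in> N; y \<in> N\<rbrakk> \<Longrightarrow> f (x \<oplus>\<^bsub>M\<^esub> y) = f x \<oplus>\<^bsub>M\<^esub> f y"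
      "\<And>a x. \<lbrakk>a \<in> carrier R; x \<in> N\<rbrakk> \<Longrightarrow> f (a \<odot>\<^bsub>M\<^esub> x) = a \<odot>\<^bsub>M\<^esub> f x"
      using NK unfolding submodule_isomorphic_iff by auto
    obtain g where g: "bij_betw g K L"
      "\<And>x y. \<lbrakk>x \<in> K; y \<in> K\<rbrakk> \<Longrightarrow> g (x \<oplus>\<^bsub>M\<^esub> y) = g x \<oplus>\<^bsub>M\<^esub> g y"
      "\<And>a x. \<lbrakk>a \<in> carrier R; x \<in> K\<rbrakk> \<Longrightarrow> g (a \<odot>\<^bsub>M\<^esub> x) = a \<odot>\<^bsub>M\<^esub> g x"
      using KL unfolding submodule_isomorphic_iff by auto
    have fK: "f x \<in> K" if "x \<in> N" for x using bij_betwE[OF f(1)] that by simp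
    show ?thesis
      unfolding submodule_isomorphic_iff
      using bij_betw_trans[OF f(1) g(1)] f(2,3) g(2,3) fK by (intro exI[of _ "g \<circ> f"]) simp
  qed
  show ?thesis
    unfolding equivalence_on_def
  proof (intro conjI)
    show "reflp_on {N. submodule N R M} (submodule_isomorphic R M)"
      by (rule reflp_onI) (rule refl)
    show "symp_on {N. submodule N R M} (submodule_isomorphic R M)"
      by (rule symp_onI) (simp add: sym)
    show "transp_on {N. submodule N R M} (submodule_isomorphic R M)"
      by (rule transp_onI) (rule trans)
  qed
qed

text \<open>The map \<open>a + b \<mapsto> f a + g b\<close> is well defined and bijective because both sums are direct.\<close>

lemma splits_isomorphic:
  assumes s: "splits L A B" and s': "splits L' A' B'"
    and "submodule_isomorphic R M A A'" "submodule_isomorphic R M B B'"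
  shows "submodule_isomorphic R M L L'"
proof -
  obtain f g where f: "bij_betw f A A'"
      "\<And>x y. \<lbrakk>x \<in> A; y \<in> A\<rbrakk> \<Longrightarrow> f (x \<oplus>\<^bsub>M\<^esub> y) = f x \<oplus>\<^bsub>M\<^esub> f y"
      "\<And>a x. \<lbrakk>a \<in> carrier R; x \<in> A\<rbrakk> \<Longrightarrow> f (a \<odot>\<^bsub>M\<^esub> x) = a \<odot>\<^bsub>M\<^esub> f x"
      and g: "bij_betw g B B'"
      "\<And>x y. \<lbrakk>x \<in> B; y \<in> B\<rbrakk> \<Longrightarrow> g (x \<oplus>\<^bsub>M\<^esub> y) = g x \<oplus>\<^bsub>M\<^esub> g y"
      "\<And>a x. \<lbrakk>a \<in> carrier R; x \<in> B\<rbrakk> \<Longrightarrow> g (a \<odot>\<^bsub>M\<^esub> x) = a \<odot>\<^bsub>M\<^esub> g x"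
    using assms(3,4) unfolding submodule_isomorphic_iff by auto
  note sub = splits_submodule[OF s] and sub' = splits_submodule[OF s']
  have fA: "f x \<in> A'" if "x \<in> A" for x using bij_betwE[OF f(1)] that by simp
  have gB: "g x \<in> B'" if "x \<in> B" for x using bij_betwE[OF g(1)] that by simp
  note c = submodule_carrier[OF sub(2)] submodule_carrier[OF sub(3)]
    submodule_carrier[OF sub'(2)] submodule_carrier[OF sub'(3)]
  define h where "h m = (THE y. \<exists>a \<in> A. \<exists>b \<in> B. m = a \<oplus>\<^bsub>M\<^esub> b \<and> y = f a \<oplus>\<^bsub>M\<^esub> g b)" for m
  have h: "h (a \<oplus>\<^bsub>M\<^esub> b) = f a \<oplus>\<^bsub>M\<^esub> g b" if ab: "a \<in> A" "b \<in> B" for a b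
    unfolding h_def
  proof (rule the_equality)
    show "\<exists>a' \<in> A. \<exists>b' \<in> B. a \<oplus>\<^bsub>M\<^esub> b = a' \<oplus>\<^bsub>M\<^esub> b' \<and> f a \<oplus>\<^bsub>M\<^esub> g b = f a' \<oplus>\<^bsub>M\<^esub> g b'"
      using ab by (intro bexI[of _ a] bexI[of _ b]) simp_all
    fix y assume "\<exists>a' \<in> A. \<exists>b' \<in> B. a \<oplus>\<^bsub>M\<^esub> b = a' \<oplus>\<^bsub>M\<^esub> b' \<and> y = f a' \<oplus>\<^bsub>M\<^esub> g b'"
    then show "y = f a \<oplus>\<^bsub>M\<^esub> g b" using splits_add_eq_iff[OF s ab(1) _ ab(2)] by auto
  qed
  have "inj_on h L"
  proof (rule inj_onI)
    fix m n assume "m \<in> L" "n \<in> L" and eq: "h m = h n"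
    then obtain a b a' b' where m: "a \<in> A" "b \<in> B" "m = a \<oplus>\<^bsub>M\<^esub> b"
      and n: "a' \<in> A" "b' \<in> B" "n = a' \<oplus>\<^bsub>M\<^esub> b'" by (metis splitsE[OF s])
    have "f a = f a' \<and> g b = g b'"
      using splits_add_eq_iff[OF s' fA[OF m(1)] fA[OF n(1)] gB[OF m(2)] gB[OF n(2)]]
        eq m n h by simp
    then show "m = n"
      using f(1) g(1) m n unfolding bij_betw_def inj_on_def by auto
  qed
  moreover have "h ` L \<subseteq> L'"
  proof
    fix y assume "y \<in> h ` L"
    then obtain m where "m \<in> L" "y = h m" by auto
    moreover from this obtain a b where "a \<in> A" "b \<in> B" "m = a \<oplus>\<^bsub>M\<^esub> b" by (metis splitsE[OF s])
    ultimately show "y \<in> L'" using h fA gB splits_addI[OF s'] by simp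
  qed
  moreover have "L' \<subseteq> h ` L"
  proof
    fix y assume "y \<in> L'"
    then obtain a' b' where y: "a' \<in> A'" "b' \<in> B'" "y = a' \<oplus>\<^bsub>M\<^esub> b'" by (metis splitsE[OF s'])
    obtain a b where "a \<in> A" "b \<in> B" "a' = f a" "b' = g b"
      using y(1,2) bij_betw_imp_surj_on[OF f(1)] bij_betw_imp_surj_on[OF g(1)] by auto
    then show "y \<in> h ` L" using y(3) h splits_addI[OF s] by (metis image_eqI)
  qed
  ultimately have "bij_betw h L L'" unfolding bij_betw_def by auto
  moreover have "h (m \<oplus>\<^bsub>M\<^esub> n) = h m \<oplus>\<^bsub>M\<^esub> h n" if mn: "m \<in> L" "n \<in> L" for m n
  proof -
    obtain a b a' b' where m: "a \<in> A" "b \<in> B" "m = a \<oplus>\<^bsub>M\<^esub> b"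
      and n: "a' \<in> A" "b' \<in> B" "n = a' \<oplus>\<^bsub>M\<^esub> b'" using mn by (metis splitsE[OF s])
    have "m \<oplus>\<^bsub>M\<^esub> n = (a \<oplus>\<^bsub>M\<^esub> a') \<oplus>\<^bsub>M\<^esub> (b \<oplus>\<^bsub>M\<^esub> b')"
      using m n c by (simp add: M.a_ac)
    then have "h (m \<oplus>\<^bsub>M\<^esub> n) = (f a \<oplus>\<^bsub>M\<^esub> f a') \<oplus>\<^bsub>M\<^esub> (g b \<oplus>\<^bsub>M\<^esub> g b')"
      using h m n f(2) g(2) submodule_add[OF sub(2)] submodule_add[OF sub(3)] by simp
    also have "\<dots> = (f a \<oplus>\<^bsub>M\<^esub> g b) \<oplus>\<^bsub>M\<^esub> (f a' \<oplus>\<^bsub>M\<^esub> g b')"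
      using m n fA gB c by (simp add: M.a_ac)
    finally show ?thesis using h m n by simp
  qed
  moreover have "h (r \<odot>\<^bsub>M\<^esub> m) = r \<odot>\<^bsub>M\<^esub> h m" if rm: "r \<in> carrier R" "m \<in> L" for r m
  proof -
    obtain a b where m: "a \<in> A" "b \<in> B" "m = a \<oplus>\<^bsub>M\<^esub> b" using rm(2) by (metis splitsE[OF s])
    then have "r \<odot>\<^bsub>M\<^esub> m = r \<odot>\<^bsub>M\<^esub> a \<oplus>\<^bsub>M\<^esub> r \<odot>\<^bsub>M\<^esub> b" using c rm by (simp add: smult_r_distr)
    then show ?thesis
      using h m f(3) g(3) fA gB c rm submodule_smult[OF sub(2)] submodule_smult[OF sub(3)]
      by (simp add: smult_r_distr)
  qed
  ultimately show ?thesis unfolding submodule_isomorphic_iff by (intro exI[of _ h]) simp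
qed

section \<open>Decompositions of submodules\<close>

abbreviation decompositions :: "'m set \<Rightarrow> 'm set set set"
  where "decompositions L \<equiv> direct_decompositions R (M\<lparr>carrier := L\<rparr>)"

abbreviation indecomposable :: "'m set \<Rightarrow> bool"
  where "indecomposable N \<equiv> indecomposable_module R (M\<lparr>carrier := N\<rparr>)"

lemma splits_restrict:
  assumes L: "submodule L R M"
  shows "left_module.splits R (M\<lparr>carrier := L\<rparr>) (carrier (M\<lparr>carrier := L\<rparr>)) A B \<longleftrightarrow> splits L A B"
proof -
  interpret L: left_module R "M\<lparr>carrier := L\<rparr>" by (rule left_module_restrict[OF L])
  show ?thesis
    using L.complementary_submodules_iff_splits_carrier[of A B]
      complementary_submodules_iff_splits[OF L, of A B] by simp
qed

text \<open>This and the next lemma are the two insertion lemmas above for the module \<open>M\<lparr>carrier := L\<rparr>\<close>, phrased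
  in terms of \<open>M\<close> alone.\<close>

lemma decompositions_insertI:
  assumes "finite D" "N \<noteq> {\<zero>\<^bsub>M\<^esub>}" "splits L N K" "D \<in> decompositions K"
  shows "N \<notin> D" "insert N D \<in> decompositions L"
proof -
  have L: "submodule L R M" using splits_submodule[OF assms(3)] by simp
  interpret L: left_module R "M\<lparr>carrier := L\<rparr>" by (rule left_module_restrict[OF L])
  have "N \<notin> D \<and> insert N D \<in> decompositions L"
    using L.insert_decompositionI[of D N K] assms splits_restrict[OF L, of N K] by simp
  then show "N \<notin> D" "insert N D \<in> decompositions L" by simp_all
qed

lemma decompositions_insertE:
  assumes L: "submodule L R M" and "finite D" "N \<notin> D" "insert N D \<in> decompositions L"
  obtains K where "N \<noteq> {\<zero>\<^bsub>M\<^esub>}" "splits L N K" "D \<in> decompositions K"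
proof -
  interpret L: left_module R "M\<lparr>carrier := L\<rparr>" by (rule left_module_restrict[OF L])
  show thesis
    using L.insert_decompositionE[OF assms(2-4)] splits_restrict[OF L] that by auto
qed

lemma empty_decompositions_iff:
  assumes L: "submodule L R M"
  shows "{} \<in> decompositions L \<longleftrightarrow> L = {\<zero>\<^bsub>M\<^esub>}"
proof -
  interpret L: left_module R "M\<lparr>carrier := L\<rparr>" by (rule left_module_restrict[OF L])
  show ?thesis
    using submodule_zero[OF L] L.M.finsum_empty
    by (subst L.direct_decompositions_finite_iff) auto
qed

text \<open>Induction on \<open>D\<close>: split off a member \<open>N\<close> and its partner \<open>\<phi> N\<close>; the rests are still matched and
  decompose complements of \<open>N\<close> and \<open>\<phi> N\<close>.\<close>

lemma isomorphic_if_decompositions_matched: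
  assumes "finite D" "submodule L R M" "submodule L' R M"
    and "D \<in> decompositions L" "E \<in> decompositions L'"
    and "matched (submodule_isomorphic R M) D E"
  shows "submodule_isomorphic R M L L'"
  using assms
proof (induction D arbitrary: L L' E rule: finite_induct)
  case empty
  then have "E = {}" unfolding matched_def bij_betw_def by auto
  then have "L = {\<zero>\<^bsub>M\<^esub>}" "L' = {\<zero>\<^bsub>M\<^esub>}" using empty empty_decompositions_iff by auto
  then show ?case
    using equivalence_onD(1)[OF equivalence_on_submodule_isomorphic] empty by simp
next
  case (insert N D)
  obtain \<phi> where \<phi>: "bij_betw \<phi> (insert N D) E"
    "\<And>A. A \<in> insert N D \<Longrightarrow> submodule_isomorphic R M A (\<phi> A)"
    using insert.prems(5) unfolding matched_def by auto
  obtain K where K: "splits L N K" "D \<in> decompositions K"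
    using decompositions_insertE[OF insert.prems(1) insert.hyps insert.prems(3)] .
  let ?E = "E - {\<phi> N}"
  have E: "E = insert (\<phi> N) ?E" "finite ?E" "\<phi> N \<notin> ?E"
    using bij_betwE[OF \<phi>(1)] bij_betw_finite[OF \<phi>(1)] insert.hyps by auto
  then obtain K' where K': "splits L' (\<phi> N) K'" "?E \<in> decompositions K'"
    using decompositions_insertE[OF insert.prems(2), of ?E "\<phi> N"] insert.prems(4) by metis
  have "bij_betw \<phi> D ?E"
    using bij_betw_DiffI[OF \<phi>(1), of "{N}" "{\<phi> N}"] bij_betwE[OF \<phi>(1)] insert.hyps
    by (simp add: bij_betw_def)
  then have "matched (submodule_isomorphic R M) D ?E"
    unfolding matched_def using \<phi>(2) by auto
  then have "submodule_isomorphic R M K K'"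
    using insert.IH[OF _ _ K(2) K'(2)] splits_submodule[OF K(1)] splits_submodule[OF K'(1)]
    by simp
  then show ?case using splits_isomorphic[OF K(1) K'(1) \<phi>(2)[of N]] by simp
qed

text \<open>A finite decomposition of maximal cardinality is indecomposable: replacing a member by two nonzero
  summands of it gives a larger decomposition.\<close>

lemma exists_indecomposable_decomposition:
  assumes L: "submodule L R M"
    and bound: "\<And>D. \<lbrakk>D \<in> decompositions L; finite D\<rbrakk> \<Longrightarrow> card D \<le> n"
  obtains E where "E \<in> decompositions L" "finite E" "\<And>N. N \<in> E \<Longrightarrow> indecomposable N"
proof -
  let ?P = "\<lambda>D. D \<in> decompositions L \<and> finite D"
  have "\<exists>D. ?P D"
  proof (cases "L = {\<zero>\<^bsub>M\<^esub>}")
    case True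
    then show ?thesis using empty_decompositions_iff[OF L] by (intro exI[of _ "{}"]) simp
  next
    case False
    have z: "submodule {\<zero>\<^bsub>M\<^esub>} R M" by (rule submoduleI) (auto simp: smult_zero)
    have "splits L L {\<zero>\<^bsub>M\<^esub>}"
      using L z submodule_zero[OF L] submodule_carrier[OF L] unfolding splits_def
      by (auto simp: set_eq_iff set_add_iff)
    then have "insert L {} \<in> decompositions L"
      using decompositions_insertI(2)[of "{}" L L "{\<zero>\<^bsub>M\<^esub>}"] False empty_decompositions_iff[OF z]
      by simp
    then show ?thesis by (intro exI[of _ "{L}"]) simp
  qed
  then obtain E where E: "?P E" and max: "\<And>D. ?P D \<Longrightarrow> card D \<le> card E"
    using ex_has_greatest_nat[of ?P _ card "Suc n"] bound by (metis less_Suc_eq_le)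
  have ind: "indecomposable N" if N: "N \<in> E" for N
  proof (rule ccontr)
    assume dec: "\<not> indecomposable N"
    let ?D = "E - {N}"
    have E_eq: "E = insert N ?D" and D: "finite ?D" "N \<notin> ?D" using N E by auto
    then obtain K where K: "N \<noteq> {\<zero>\<^bsub>M\<^esub>}" "splits L N K" "?D \<in> decompositions K"
      using decompositions_insertE[OF L D] E by metis
    have subN: "submodule N R M" using splits_submodule[OF K(2)] by simp
    obtain A B where AB: "A \<noteq> {\<zero>\<^bsub>M\<^esub>}" "B \<noteq> {\<zero>\<^bsub>M\<^esub>}" "splits N A B"
      using dec K(1) complementary_submodules_iff_splits[OF subN]
      unfolding indecomposable_module_def by auto
    \<comment> \<open>\<open>L = A \<oplus> (B \<oplus> K)\<close>, so \<open>A\<close> and \<open>B\<close> can take the place of \<open>N\<close>.\<close>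
    note assoc = splits_assoc[OF K(2) AB(3)]
    note B = decompositions_insertI[OF D(1) AB(2) assoc(1) K(3)]
    note A = decompositions_insertI[OF _ AB(1) assoc(2) B(2)]
    have "card (insert A (insert B ?D)) \<le> card E" using max A(2) D(1) by simp
    moreover have "card (insert A (insert B ?D)) = Suc (Suc (card ?D))"
      using A(1) B(1) D(1) by simp
    moreover have "card E = Suc (card ?D)" using D card_insert_disjoint E_eq by metis
    ultimately show False by simp
  qed
  show thesis by (rule that[of E]) (use E ind in auto)
qed

lemma decompositions_memberE:
  assumes "submodule L R M" "finite D" "D \<in> decompositions L" "N \<in> D"
  obtains K where "splits L N K"
proof -
  have "D = insert N (D - {N})" "finite (D - {N})" "N \<notin> D - {N}" using assms(2,4) by auto
  then show thesis using decompositions_insertE[OF assms(1), of "D - {N}" N] assms(3) that by metis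
qed

section \<open>Direct summands and the Krull-Schmidt length\<close>

lemma direct_summand_iff: "direct_summand R M N \<longleftrightarrow> (\<exists>K. splits (carrier M) N K)"
  unfolding direct_summand_def complementary_submodules_iff_splits_carrier ..

lemma direct_summand_trans:
  assumes "direct_summand R M L" "splits L N K"
  shows "direct_summand R M N"
  using assms splits_assoc(2) unfolding direct_summand_iff by metis

lemma direct_summand_submodule: "direct_summand R M N \<Longrightarrow> submodule N R M"
  using splits_submodule(2) unfolding direct_summand_iff by metis

text \<open>A nonzero complement of \<open>L\<close> extends \<open>E\<close> to a decomposition of \<open>M\<close>; if the complement is zero,
  then \<open>L\<close> is all of \<open>M\<close>.\<close>

lemma card_summand_decomposition_le:
  assumes L: "direct_summand R M L"
    and bound: "\<And>D. D \<in> direct_decompositions R M \<Longrightarrow> card D \<le> n"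
    and E: "E \<in> decompositions L" "finite E"
  shows "card E \<le> n"
proof -
  obtain N where "splits (carrier M) L N" using L unfolding direct_summand_iff by auto
  then have s: "splits (carrier M) N L" by (rule splits_commute)
  show ?thesis
  proof (cases "N = {\<zero>\<^bsub>M\<^esub>}")
    case True
    have "m \<in> L" if "m \<in> carrier M" for m
      using splitsE[OF s that] True submodule_carrier[OF splits_submodule(3)[OF s]] by auto
    then have "L = carrier M" using submodule_subset[OF splits_submodule(3)[OF s]] by auto
    then show ?thesis using bound[of E] E by simp
  next
    case False
    have "insert N E \<in> direct_decompositions R M" "N \<notin> E"
      using decompositions_insertI[OF E(2) False s E(1)] by simp_all
    then show ?thesis using bound[of "insert N E"] E(2) by simp
  qed
qed

lemma summand_indecomposable_decompositionE:
  assumes L: "direct_summand R M L"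
    and bound: "\<And>D. D \<in> direct_decompositions R M \<Longrightarrow> card D \<le> n"
  obtains E where "E \<in> decompositions L" "finite E" "card E \<le> n"
    "\<And>N. N \<in> E \<Longrightarrow> direct_summand R M N \<and> indecomposable N"
proof -
  have sub: "submodule L R M" using L by (rule direct_summand_submodule)
  have le: "card E \<le> n" if "E \<in> decompositions L" "finite E" for E
    by (rule card_summand_decomposition_le[OF L _ that]) (rule bound)
  obtain E where E: "E \<in> decompositions L" "finite E" "\<And>N. N \<in> E \<Longrightarrow> indecomposable N"
    using exists_indecomposable_decomposition[OF sub le] by metis
  have "direct_summand R M N" if "N \<in> E" for N
    using decompositions_memberE[OF sub E(2,1) that] direct_summand_trans[OF L] by metis
  then show thesis using that[OF E(1,2) le[OF E(1,2)]] E(3) by simp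
qed

end

lemma decomposition_isomorphic_eq_matched:
  "decomposition_isomorphic R M = matched (submodule_isomorphic R M)"
  by (intro ext) (simp add: decomposition_isomorphic_def matched_def)

text \<open>An infinite decomposition would contribute the term \<open>\<infinity>\<close> to the supremum.\<close>

lemma krull_schmidt_length_finiteD:
  assumes "krull_schmidt_length R M < \<infinity>"
  shows "\<exists>n. \<forall>D \<in> direct_decompositions R M. finite D \<and> card D \<le> n"
proof -
  obtain n where n: "krull_schmidt_length R M = enat n" using assms by auto
  have "finite D \<and> card D \<le> n" if D: "D \<in> direct_decompositions R M" for D
  proof -
    have "(if finite D then enat (card D) else \<infinity>) \<le> enat n"
      using D unfolding n[symmetric] krull_schmidt_length_def by (rule SUP_upper)
    then show ?thesis by (cases "finite D") simp_all
  qed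
  then show ?thesis by auto
qed

theorem corollary6p4:
  fixes R :: "('r, 'p) ring_scheme" and M :: "('r, 'm, 'q) module_scheme"
  assumes "left_module R M"
    and "krull_schmidt_length R M < \<infinity>"
  shows "(AKS1 R M \<longleftrightarrow> AKS2 R M) \<and> (AKS2 R M \<longleftrightarrow> AKS3 R M) \<and> (AKS3 R M \<longleftrightarrow> AKS4 R M)"
proof -
  interpret left_module R M by fact
  obtain n where n: "\<And>D. D \<in> direct_decompositions R M \<Longrightarrow> finite D \<and> card D \<le> n"
    using krull_schmidt_length_finiteD[OF assms(2)] by auto
  let ?iso = "submodule_isomorphic R M"
  let ?S = "{N. direct_summand R M N}"
  let ?I = "{N. direct_summand R M N \<and> indecomposable N}"
  have eqS: "equivalence_on ?S ?iso"
    by (rule equivalence_on_subset[OF equivalence_on_submodule_isomorphic])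
      (use direct_summand_submodule in auto)
  have eqI: "equivalence_on ?I ?iso" by (rule equivalence_on_subset[OF eqS]) auto
  have member: "direct_summand R M N" if "D \<in> direct_decompositions R M" "N \<in> D" for D N
    using decompositions_memberE[OF submodule_carrier_self, of D N] n that
    unfolding direct_summand_iff by auto
  have AKS12: "AKS2 R M" if "AKS1 R M"
    using that unfolding AKS1_def AKS2_def
    by (rule finite_up_to_mono) (auto simp: indecomposable_decompositions_def)
  \<comment> \<open>The representatives of the summands are the members of the representatives of the
    decompositions.\<close>
  have AKS24: "AKS4 R M" if AKS2: "AKS2 R M"
  proof -
    let ?C = "indecomposable_decompositions R M"
    have C: "D \<in> direct_decompositions R M" "D \<subseteq> ?I" if "D \<in> ?C" for D
      using that member[of D] unfolding indecomposable_decompositions_def by auto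
    have eqC: "equivalence_on ?C (matched ?iso)"
      using equivalence_on_matched[OF eqI] by (rule equivalence_on_subset) (use C in auto)
    obtain F where F: "finite F" "F \<subseteq> ?C" "\<And>D. D \<in> ?C \<Longrightarrow> \<exists>E \<in> F. matched ?iso D E"
      using AKS2 unfolding AKS2_def decomposition_isomorphic_eq_matched
        finite_up_to_iff_representatives[OF eqC] by auto
    have "\<exists>K \<in> \<Union>F. ?iso N K" if N: "N \<in> ?I" for N
    proof -
      obtain L where L: "splits (carrier M) N L" using N unfolding direct_summand_iff by auto
      then have "direct_summand R M L" using splits_commute unfolding direct_summand_iff by auto
      then obtain E where E: "E \<in> decompositions L" "finite E" "\<And>A. A \<in> E \<Longrightarrow> indecomposable A"
        using summand_indecomposable_decompositionE[of L n] n by metis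
      have "N \<noteq> {\<zero>\<^bsub>M\<^esub>}" using N unfolding indecomposable_module_def by simp
      then have "insert N E \<in> ?C"
        using decompositions_insertI(2)[OF E(2) _ L E(1)] E(3) N
        unfolding indecomposable_decompositions_def by simp
      then obtain G where G: "G \<in> F" "matched ?iso (insert N E) G" using F(3) by auto
      then obtain \<phi> where \<phi>: "bij_betw \<phi> (insert N E) G" "?iso N (\<phi> N)"
        unfolding matched_def by auto
      then have "\<phi> N \<in> G" using bij_betwE[OF \<phi>(1)] by simp
      then show ?thesis using G(1) \<phi>(2) by auto
    qed
    moreover have "finite (\<Union>F)"
    proof (rule finite_Union[OF F(1)])
      fix D assume "D \<in> F"
      then show "finite D" using F(2) C(1) n by auto
    qed
    moreover have "\<Union>F \<subseteq> ?I" using F(2) C(2) by (intro Union_least) auto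
    ultimately show ?thesis
      unfolding AKS4_def finite_up_to_iff_representatives[OF eqI] by (intro exI[of _ "\<Union>F"]) simp
  qed
  \<comment> \<open>A chosen indecomposable decomposition of each summand determines it up to isomorphism.\<close>
  have AKS43: "AKS3 R M" if "AKS4 R M"
  proof -
    let ?T = "{D. D \<subseteq> ?I \<and> finite D \<and> card D \<le> n}"
    have "\<forall>L \<in> ?S. \<exists>E. E \<in> decompositions L \<and> E \<in> ?T"
    proof
      fix L assume "L \<in> ?S"
      then have "direct_summand R M L" by simp
      then obtain E where "E \<in> decompositions L" "finite E" "card E \<le> n"
        "\<And>N. N \<in> E \<Longrightarrow> direct_summand R M N \<and> indecomposable N"
        using summand_indecomposable_decompositionE[of L n] n by metis
      then show "\<exists>E. E \<in> decompositions L \<and> E \<in> ?T" by (intro exI[of _ E]) auto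
    qed
    from bchoice[OF this]
    obtain dec where dec: "\<forall>L \<in> ?S. dec L \<in> decompositions L \<and> dec L \<in> ?T"
      by (rule exE)
    have eqT: "equivalence_on ?T (matched ?iso)"
      using equivalence_on_matched[OF eqI] by (rule equivalence_on_subset) auto
    show ?thesis
      unfolding AKS3_def
    proof (rule finite_up_to_pullback[OF eqS eqT])
      show "finite_up_to (matched ?iso) ?T"
        using eqI that unfolding AKS4_def by (rule finite_up_to_matched)
      show "dec L \<in> ?T" if "L \<in> ?S" for L using bspec[OF dec that] by simp
      show "?iso L K" if "L \<in> ?S" "K \<in> ?S" "matched ?iso (dec L) (dec K)" for L K
        using isomorphic_if_decompositions_matched[of "dec L" L K "dec K"] that
          bspec[OF dec that(1)] bspec[OF dec that(2)] direct_summand_submodule by simp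
    qed
  qed
  have AKS31: "AKS1 R M" if "AKS3 R M"
  proof -
    have "finite_up_to (matched ?iso) {D. D \<subseteq> ?S \<and> finite D \<and> card D \<le> n}"
      using eqS that unfolding AKS3_def by (rule finite_up_to_matched)
    then show ?thesis
      unfolding AKS1_def decomposition_isomorphic_eq_matched
      by (rule finite_up_to_mono) (use member n in auto)
  qed
  show ?thesis using AKS12 AKS24 AKS43 AKS31 by auto
qed

end
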